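(* There is a universal constant $C$ such that the following holds. Let $N\ge 1$ and let $\xi_1<\dots<\xi_N$ be arbitrary real numbers. Let $f\in L^1(\mathbb{R})$ and let $\lambda>0$. Then there is a decomposition $$f=g+\sum_{I\in \mathbf{I}} b_I$$ for some collection $\mathbf{I}$ of pairwise disjoint intervals with $$\sum_{I\in \mathbf{I}} |I|\le C N^{1/2} \|f\|_{L^1}\lambda^{-1},$$ such that $$\|g\|_{L^2}^2\le C \|f\|_{L^1} N^{1/2} \lambda ,$$ and such that for each $I\in \mathbf{I}$ and each $1\le j\le N$: $$\|f_I\|_{L^1}\le C|I|\lambda,\qquad \|f_I - b_I\|_{L^2} \le C|I|^{1/2} \lambda N^{1/2},\qquad \int_{\mathbb{R}} b_I(x) e^{i\xi_j x}\, dx=0,$$ where $f_I=f\cdot 1_I$ is the product of $f$ with the characteristic function of $I$, and the support of $b_I$ is contained in $3I$.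
   Context: For an interval $I$, $|I|$ denotes its length and $3I$ denotes the interval with the same center as $I$ and three times its length. *)

theory Defs
  imports "HOL-Analysis.Analysis"
begin

definition real_interval :: "real set \<Rightarrow> bool" where
  "real_interval I \<longleftrightarrow> is_interval I \<and> bounded I \<and> Inf I < Sup I"

definition ilen :: "real set \<Rightarrow> real" where
  "ilen I = Sup I - Inf I"

definition triple :: "real set \<Rightarrow> real set" where
  "triple I = {(Inf I + Sup I) / 2 - 3 / 2 * ilen I .. (Inf I + Sup I) / 2 + 3 / 2 * ilen I}"

end

theory Submission
  imports Defs
begin

text \<open>
  The span \<open>V\<close> of the exponentials \<open>x \<mapsto> e\<^bsup>i \<xi>\<^sub>j x\<^esup>\<close> is translation invariant and of dimension at most
  \<open>N\<close>. On an interval of length \<open>\<ell>\<close>, the squared norms of the point evaluations on \<open>V \<subseteq> L\<^sup>2\<close> integrate to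
  at most \<open>N\<close>, so one of them is at most \<open>N / \<ell>\<close>, and by translation invariance every point of \<open>I\<close>
  satisfies \<open>|p(x)|\<^sup>2 \<le> (2 N / |I|) \<integral>\<^bsub>2I\<^esub> |p|\<^sup>2\<close>. By duality the functional \<open>p \<mapsto> \<integral>\<^sub>I f p\<close> is represented by
  some \<open>h\<^sub>I\<close> supported in \<open>2I\<close> with \<open>\<parallel>h\<^sub>I\<parallel>\<^sub>2 \<le> sqrt (2 N / |I|) \<parallel>f\<^sub>I\<parallel>\<^sub>1\<close>, and \<open>b\<^sub>I = f\<^sub>I - h\<^sub>I\<close> has vanishing moments.
  The intervals \<open>I\<close> are the maximal dyadic ones whose triple lies in the union of the triples of the
  dyadic intervals on which \<open>|f|\<close> has average above \<open>\<lambda> / sqrt N\<close>. This Whitney-type choice makes the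
  doubles \<open>2I\<close> overlap boundedly, so that \<open>\<Sum> h\<^sub>I\<close> is controlled in \<open>L\<^sup>2\<close>.
\<close>

section \<open>Exponential sums on an interval\<close>

definition l2_inner :: "real \<Rightarrow> real \<Rightarrow> (real \<Rightarrow> complex) \<Rightarrow> (real \<Rightarrow> complex) \<Rightarrow> complex" where
  "l2_inner a b p q = (LINT x:{a..b}|lborel. p x * cnj (q x))"

lemma l2_inner_commute: "l2_inner a b q p = cnj (l2_inner a b p q)"
proof -
  have "l2_inner a b q p = (LINT x|lborel. cnj (indicator {a..b} x *\<^sub>R (p x * cnj (q x))))"
    unfolding l2_inner_def set_lebesgue_integral_def
    by (intro Bochner_Integration.integral_cong) (auto simp: indicator_def)
  also have "\<dots> = cnj (l2_inner a b p q)"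
    unfolding l2_inner_def set_lebesgue_integral_def by (rule Bochner_Integration.integral_cnj)
  finally show ?thesis .
qed

lemma l2_inner_self:
  "l2_inner a b p p = of_real (LINT x:{a..b}|lborel. (cmod (p x))\<^sup>2)"
  unfolding l2_inner_def
  by (simp add: complex_mult_cnj cmod_power2 flip: set_integral_complex_of_real)

lemma l2_inner_sum_left:
  assumes "\<And>i. i < M \<Longrightarrow> continuous_on {a..b} (u i)" "continuous_on {a..b} q"
  shows "l2_inner a b (\<lambda>x. \<Sum>i<M. c i * u i x) q = (\<Sum>i<M. c i * l2_inner a b (u i) q)"
proof -
  have "set_integrable lborel {a..b} (\<lambda>x. c i * (u i x * cnj (q x)))" if "i < M" for i
    by (intro borel_integrable_atLeastAtMost' continuous_intros assms that)
  then have "(LINT x:{a..b}|lborel. \<Sum>i\<in>{..<M}. c i * (u i x * cnj (q x)))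
      = (\<Sum>i<M. LINT x:{a..b}|lborel. c i * (u i x * cnj (q x)))"
    unfolding set_lebesgue_integral_def set_integrable_def scaleR_sum_right
    by (intro Bochner_Integration.integral_sum) auto
  then show ?thesis
    by (simp add: l2_inner_def sum_distrib_right mult.assoc)
qed

lemma l2_inner_diff_left:
  assumes "continuous_on {a..b} p" "continuous_on {a..b} p'" "continuous_on {a..b} q"
  shows "l2_inner a b (\<lambda>x. p x - p' x) q = l2_inner a b p q - l2_inner a b p' q"
  unfolding l2_inner_def left_diff_distrib
  by (intro set_integral_diff(2) borel_integrable_atLeastAtMost' continuous_intros assms)

text \<open>A continuous nonnegative function with zero integral vanishes at every point, not just
  almost everywhere. This lets Gram-Schmidt discard a vector whose residual has norm zero.\<close>

lemma l2_inner_self_eq_0_imp: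
  assumes "a < b" "continuous_on {a..b} p" "l2_inner a b p p = 0" "x \<in> {a..b}"
  shows "p x = 0"
proof -
  have c: "continuous_on {a..b} (\<lambda>x. (cmod (p x))\<^sup>2)"
    by (intro continuous_intros assms)
  have "integral {a..b} (\<lambda>x. (cmod (p x))\<^sup>2) = (LINT x:{a..b}|lborel. (cmod (p x))\<^sup>2)"
    using set_borel_integral_eq_integral(2)[OF borel_integrable_atLeastAtMost'[OF c]] by simp
  also have "\<dots> = 0"
    using assms(3) unfolding l2_inner_self by (metis of_real_eq_0_iff)
  finally have "((\<lambda>x. (cmod (p x))\<^sup>2) has_integral 0) (cbox a b)"
    using integrable_integral[OF integrable_continuous_interval[OF c]] by simp
  from has_integral_0_cbox_imp_0[OF _ _ this, of x] show ?thesis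
    using c assms by auto
qed

definition orthonormal_on :: "real \<Rightarrow> real \<Rightarrow> nat \<Rightarrow> (nat \<Rightarrow> real \<Rightarrow> complex) \<Rightarrow> bool" where
  "orthonormal_on a b M u \<longleftrightarrow> (\<forall>i<M. continuous_on {a..b} (u i)) \<and>
     (\<forall>i<M. \<forall>k<M. l2_inner a b (u i) (u k) = (if i = k then 1 else 0))"

lemma orthonormal_on_inner_sum:
  assumes "orthonormal_on a b M u" "k < M"
  shows "l2_inner a b (\<lambda>x. \<Sum>i<M. d i * u i x) (u k) = d k"
proof -
  have "l2_inner a b (\<lambda>x. \<Sum>i<M. d i * u i x) (u k) = (\<Sum>i<M. d i * l2_inner a b (u i) (u k))"
    using assms by (intro l2_inner_sum_left) (auto simp: orthonormal_on_def)
  also have "\<dots> = (\<Sum>i<M. if i = k then d i else 0)"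
    using assms by (intro sum.cong) (auto simp: orthonormal_on_def)
  finally show ?thesis
    using assms(2) by simp
qed

lemma orthonormal_on_parseval:
  assumes o: "orthonormal_on a b M u"
  shows "(LINT x:{a..b}|lborel. (cmod (\<Sum>i<M. d i * u i x))\<^sup>2) = (\<Sum>i<M. (cmod (d i))\<^sup>2)"
proof -
  let ?p = "\<lambda>x. \<Sum>i<M. d i * u i x"
  have c: "continuous_on {a..b} (u i)" if "i < M" for i
    using o that by (auto simp: orthonormal_on_def)
  have "l2_inner a b ?p ?p = (\<Sum>i<M. d i * l2_inner a b (u i) ?p)"
    by (intro l2_inner_sum_left continuous_intros c) auto
  also have "\<dots> = (\<Sum>i<M. d i * cnj (d i))"
    by (intro sum.cong refl, subst l2_inner_commute)
      (simp add: orthonormal_on_inner_sum[OF o])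
  also have "\<dots> = of_real (\<Sum>i<M. (cmod (d i))\<^sup>2)"
    by (simp add: complex_mult_cnj cmod_power2)
  finally show ?thesis
    unfolding l2_inner_self by (simp only: of_real_eq_iff)
qed

text \<open>Linear dependence is allowed: a residual of norm zero adds no basis vector, hence
  \<open>M \<le> N\<close>. The \<open>u i\<close> are combinations of the \<open>e j\<close> on the
  whole line, so they inherit continuity and the evaluation bounds there. The converse holds only on
  \<open>{a..b}\<close>, because a vanishing residual says nothing outside the interval.\<close>

lemma gram_schmidt:
  fixes e :: "nat \<Rightarrow> real \<Rightarrow> complex"
  assumes "a < b" "\<And>j. j < N \<Longrightarrow> continuous_on {a..b} (e j)"
  shows "\<exists>M u. M \<le> N \<and> orthonormal_on a b M u \<and>
      (\<forall>i<M. \<exists>c. \<forall>x. u i x = (\<Sum>j<N. c j * e j x)) \<and>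
      (\<forall>j<N. \<exists>c. \<forall>x\<in>{a..b}. e j x = (\<Sum>i<M. c i * u i x))"
  using assms(2)
proof (induction N)
  case 0
  show ?case by (rule exI[of _ 0]) (auto simp: orthonormal_on_def)
next
  case (Suc N)
  have "\<And>j. j < N \<Longrightarrow> continuous_on {a..b} (e j)"
    by (rule Suc.prems) simp
  from Suc.IH[OF this] obtain M u where M: "M \<le> N" and o: "orthonormal_on a b M u"
    and span1: "\<forall>i<M. \<exists>c. \<forall>x. u i x = (\<Sum>j<N. c j * e j x)"
    and span2: "\<forall>j<N. \<exists>c. \<forall>x\<in>{a..b}. e j x = (\<Sum>i<M. c i * u i x)"
    by blast
  from span1 obtain C where C: "\<And>i x. i < M \<Longrightarrow> u i x = (\<Sum>j<N. C i j * e j x)"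
    by metis
  have cu: "continuous_on {a..b} (u i)" if "i < M" for i
    using o that by (auto simp: orthonormal_on_def)
  have ce: "continuous_on {a..b} (e N)"
    by (rule Suc.prems) simp
  define d where "d i = l2_inner a b (e N) (u i)" for i
  define r where "r x = e N x - (\<Sum>i<M. d i * u i x)" for x
  have cr: "continuous_on {a..b} r"
    unfolding r_def by (intro continuous_intros ce cu) auto
  have r_orth: "l2_inner a b r (u k) = 0" if "k < M" for k
  proof -
    have "l2_inner a b r (u k) = d k - l2_inner a b (\<lambda>x. \<Sum>i<M. d i * u i x) (u k)"
      unfolding r_def d_def using that
      by (intro l2_inner_diff_left continuous_intros ce cu) auto
    then show ?thesis
      using orthonormal_on_inner_sum[OF o that] by simp
  qed
  have span1': "\<exists>c. \<forall>x. u i x = (\<Sum>j<Suc N. c j * e j x)" if "i < M" for i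
    by (rule exI[of _ "(C i)(N := 0)"]) (simp add: C[OF that])
  show ?case
  proof (cases "l2_inner a b r r = 0")
    case True
    have "e N x = (\<Sum>i<M. d i * u i x)" if "x \<in> {a..b}" for x
      using l2_inner_self_eq_0_imp[OF assms(1) cr True that] by (simp add: r_def)
    then have "\<forall>j<Suc N. \<exists>c. \<forall>x\<in>{a..b}. e j x = (\<Sum>i<M. c i * u i x)"
      using span2 less_Suc_eq by metis
    then show ?thesis
      using M o span1' by (intro exI[of _ M] exI[of _ u]) auto
  next
    case False
    define s where "s = sqrt (LINT x:{a..b}|lborel. (cmod (r x))\<^sup>2)"
    have "0 \<le> (LINT x:{a..b}|lborel. (cmod (r x))\<^sup>2)"
      unfolding set_lebesgue_integral_def by (intro integral_nonneg_AE) auto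
    then have s2: "l2_inner a b r r = of_real (s\<^sup>2)"
      unfolding s_def l2_inner_self by simp
    with False have s0: "s \<noteq> 0" by auto
    define v where "v = u(M := \<lambda>x. r x / of_real s)"
    have vu: "v i = u i" if "i < M" for i
      using that by (simp add: v_def)
    have vM: "v M = (\<lambda>x. r x / of_real s)"
      by (simp add: v_def)
    have cv: "continuous_on {a..b} (v i)" if "i < Suc M" for i
      using that cu cr s0 by (auto simp: v_def less_Suc_eq intro!: continuous_intros)
    have MM: "l2_inner a b (v M) (v M) = 1"
    proof -
      have "l2_inner a b (v M) (v M) = (LINT x:{a..b}|lborel. r x * cnj (r x) / of_real (s\<^sup>2))"
        unfolding l2_inner_def vM by (simp add: power2_eq_square)
      also have "\<dots> = l2_inner a b r r / of_real (s\<^sup>2)"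
        unfolding l2_inner_def by (rule set_integral_divide_zero)
      finally show ?thesis
        using s2 s0 by simp
    qed
    have Mk: "l2_inner a b (v M) (v k) = 0" if "k < M" for k
    proof -
      have "l2_inner a b (v M) (v k) = (LINT x:{a..b}|lborel. r x * cnj (u k x) / of_real s)"
        unfolding l2_inner_def vM vu[OF that] by simp
      also have "\<dots> = l2_inner a b r (u k) / of_real s"
        unfolding l2_inner_def by (rule set_integral_divide_zero)
      finally show ?thesis
        using r_orth[OF that] by simp
    qed
    then have kM: "l2_inner a b (v k) (v M) = 0" if "k < M" for k
      using that by (subst l2_inner_commute) simp
    have o': "orthonormal_on a b (Suc M) v"
      unfolding orthonormal_on_def
    proof (intro conjI allI impI)
      fix i k assume "i < Suc M" "k < Suc M"
      then show "l2_inner a b (v i) (v k) = (if i = k then 1 else 0)"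
        using o MM Mk kM vu unfolding orthonormal_on_def less_Suc_eq by auto
    qed (use cv in auto)
    have "\<exists>c. \<forall>x. v M x = (\<Sum>j<Suc N. c j * e j x)"
    proof (intro exI allI)
      fix x
      have "(\<Sum>i<M. d i * u i x) = (\<Sum>i<M. \<Sum>j<N. d i * C i j * e j x)"
        by (intro sum.cong) (auto simp: C sum_distrib_left mult.assoc)
      also have "\<dots> = (\<Sum>j<N. (\<Sum>i<M. d i * C i j) * e j x)"
        by (subst sum.swap) (simp add: sum_distrib_right)
      finally have "v M x = (e N x - (\<Sum>j<N. (\<Sum>i<M. d i * C i j) * e j x)) / of_real s"
        by (simp add: vM r_def)
      then show "v M x = (\<Sum>j<Suc N. (if j = N then 1 / of_real s
          else - (\<Sum>i<M. d i * C i j) / of_real s) * e j x)"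
        by (simp add: diff_divide_distrib sum_negf) (simp add: sum_divide_distrib)
    qed
    then have s1: "\<forall>i<Suc M. \<exists>c. \<forall>x. v i x = (\<Sum>j<Suc N. c j * e j x)"
      using span1' vu less_Suc_eq by metis
    have "\<exists>c. \<forall>x\<in>{a..b}. e j x = (\<Sum>i<Suc M. c i * v i x)" if "j < Suc N" for j
    proof (cases "j = N")
      case True
      show ?thesis
        \<comment> \<open>Solving the definition of \<open>r\<close> for \<open>e N\<close>: the
          residual is \<open>s\<close> times the new basis vector.\<close>
        by (rule exI[of _ "d(M := of_real s)"]) (use s0 True in \<open>simp add: vM vu r_def\<close>)
    next
      case False
      with that span2 obtain c where "\<forall>x\<in>{a..b}. e j x = (\<Sum>i<M. c i * u i x)"
        by (metis less_Suc_eq)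
      then show ?thesis
        by (intro exI[of _ "c(M := 0)"]) (simp add: vu)
    qed
    with o' s1 M show ?thesis
      by (intro exI[of _ "Suc M"] exI[of _ v]) auto
  qed
qed

section \<open>Point evaluations and moments of exponential sums\<close>

lemma sum_cauchy_schwarz_complex:
  fixes c d :: "'a \<Rightarrow> complex"
  shows "(cmod (\<Sum>i\<in>A. c i * d i))\<^sup>2 \<le> (\<Sum>i\<in>A. (cmod (c i))\<^sup>2) * (\<Sum>i\<in>A. (cmod (d i))\<^sup>2)"
proof -
  have "(cmod (\<Sum>i\<in>A. c i * d i))\<^sup>2 \<le> (\<Sum>i\<in>A. cmod (c i) * cmod (d i))\<^sup>2"
    by (intro power_mono order.trans[OF norm_sum]) (auto simp: norm_mult)
  also have "\<dots> \<le> (\<Sum>i\<in>A. (cmod (c i))\<^sup>2) * (\<Sum>i\<in>A. (cmod (d i))\<^sup>2)"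
    by (rule Cauchy_Schwarz_ineq_sum)
  finally show ?thesis .
qed

text \<open>Composition of two coefficient matrices. It is used in both directions between
  exponentials and orthonormal basis, over \<open>{a..b}\<close> and over
  \<open>UNIV\<close>.\<close>

lemma sum_combination:
  fixes e u :: "nat \<Rightarrow> real \<Rightarrow> complex"
  assumes "\<And>j. j < N \<Longrightarrow> \<exists>c. \<forall>x\<in>A. e j x = (\<Sum>i<M. c i * u i x)"
  shows "\<exists>d. \<forall>x\<in>A. (\<Sum>j<N. c j * e j x) = (\<Sum>i<M. d i * u i x)"
proof -
  obtain C where C: "\<And>j x. j < N \<Longrightarrow> x \<in> A \<Longrightarrow> e j x = (\<Sum>i<M. C j i * u i x)"
    using assms by metis
  show ?thesis
  proof (intro exI ballI)
    fix x assume "x \<in> A"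
    then have "(\<Sum>j<N. c j * e j x) = (\<Sum>j<N. \<Sum>i<M. c j * C j i * u i x)"
      by (intro sum.cong) (auto simp: C sum_distrib_left mult.assoc)
    also have "\<dots> = (\<Sum>i<M. (\<Sum>j<N. c j * C j i) * u i x)"
      by (subst sum.swap) (simp add: sum_distrib_right)
    finally show "(\<Sum>j<N. c j * e j x) = (\<Sum>i<M. (\<Sum>j<N. c j * C j i) * u i x)" .
  qed
qed

text \<open>The squared norm of point evaluation at \<open>y\<close> on an \<open>M\<close>-dimensional space with orthonormal
  basis \<open>u\<close> is \<open>\<Sum>i<M. |u\<^sub>i(y)|\<^sup>2\<close>, whose integral is \<open>M\<close>; some \<open>y\<close> does not exceed the average.\<close>

lemma exists_point_evaluation_bound:
  fixes e :: "nat \<Rightarrow> real \<Rightarrow> complex"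
  assumes ab: "a < b" and ce: "\<And>j. j < N \<Longrightarrow> continuous_on {a..b} (e j)"
  shows "\<exists>y\<in>{a..b}. \<forall>c. (cmod (\<Sum>j<N. c j * e j y))\<^sup>2 * (b - a)
           \<le> real N * (LINT x:{a..b}|lborel. (cmod (\<Sum>j<N. c j * e j x))\<^sup>2)"
proof -
  obtain M u where M: "M \<le> N" and o: "orthonormal_on a b M u"
    and span: "\<forall>j<N. \<exists>c. \<forall>x\<in>{a..b}. e j x = (\<Sum>i<M. c i * u i x)"
    using gram_schmidt[of a b N e] ab ce by blast
  have cu: "continuous_on {a..b} (u i)" if "i < M" for i
    using o that by (auto simp: orthonormal_on_def)
  define K where "K x = (\<Sum>i<M. (cmod (u i x))\<^sup>2)" for x
  have cK: "continuous_on {a..b} K"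
    unfolding K_def by (intro continuous_intros cu) auto
  obtain y where y: "y \<in> {a..b}" "\<And>x. x \<in> {a..b} \<Longrightarrow> K y \<le> K x"
    using continuous_attains_inf[OF compact_Icc _ cK] ab by auto
  have "(LINT x:{a..b}|lborel. (cmod (u i x))\<^sup>2) = 1" if "i < M" for i
    using o that l2_inner_self[of a b "u i"] unfolding orthonormal_on_def
    by (metis (full_types) of_real_eq_1_iff)
  moreover have "(LINT x:{a..b}|lborel. K x) = (\<Sum>i<M. LINT x:{a..b}|lborel. (cmod (u i x))\<^sup>2)"
  proof -
    have "set_integrable lborel {a..b} (\<lambda>x. (cmod (u i x))\<^sup>2)" if "i < M" for i
      by (intro borel_integrable_atLeastAtMost' continuous_intros cu that)
    then show ?thesis
      unfolding K_def set_lebesgue_integral_def set_integrable_def scaleR_sum_right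
      by (intro Bochner_Integration.integral_sum) auto
  qed
  ultimately have intK: "(LINT x:{a..b}|lborel. K x) = real M"
    by simp
  have "K y * (b - a) = (LINT x:{a..b}|lborel. K y)"
    using ab by (simp add: set_lebesgue_integral_def)
  also have "\<dots> \<le> (LINT x:{a..b}|lborel. K x)"
    by (intro set_integral_mono borel_integrable_atLeastAtMost' cK y) auto
  finally have Ky: "K y * (b - a) \<le> real N"
    using M by (simp add: intK)
  show ?thesis
  proof (intro bexI[OF _ y(1)] allI)
    fix c
    obtain d where d: "\<And>x. x \<in> {a..b} \<Longrightarrow> (\<Sum>j<N. c j * e j x) = (\<Sum>i<M. d i * u i x)"
      using sum_combination[where N = N and A = "{a..b}" and e = e and M = M and u = u and c = c] span by auto
    \<comment> \<open>In the orthonormal basis the integral is the Euclidean norm of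
      \<open>d\<close>, so Cauchy-Schwarz against the values \<open>u i y\<close> bounds the
      evaluation by \<open>K y\<close>.\<close>
    have D: "(LINT x:{a..b}|lborel. (cmod (\<Sum>j<N. c j * e j x))\<^sup>2) = (\<Sum>i<M. (cmod (d i))\<^sup>2)"
      unfolding orthonormal_on_parseval[OF o, symmetric]
      by (intro set_lebesgue_integral_cong) (auto simp: d)
    have "(cmod (\<Sum>j<N. c j * e j y))\<^sup>2 * (b - a) \<le> (\<Sum>i<M. (cmod (d i))\<^sup>2) * K y * (b - a)"
      using ab y(1) unfolding K_def
      by (intro mult_right_mono) (auto simp: d intro!: sum_cauchy_schwarz_complex)
    also have "\<dots> = (\<Sum>i<M. (cmod (d i))\<^sup>2) * (K y * (b - a))"
      by simp
    also have "\<dots> \<le> (\<Sum>i<M. (cmod (d i))\<^sup>2) * real N"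
      by (intro mult_left_mono Ky sum_nonneg) auto
    finally show "(cmod (\<Sum>j<N. c j * e j y))\<^sup>2 * (b - a)
           \<le> real N * (LINT x:{a..b}|lborel. (cmod (\<Sum>j<N. c j * e j x))\<^sup>2)"
      unfolding D by (simp add: mult.commute)
  qed
qed

lemma continuous_on_cis_mult: "continuous_on A (\<lambda>x. cis (r * x))"
  unfolding cis_conv_exp by (intro continuous_intros)

text \<open>The span of the exponentials is translation invariant, so the good evaluation point can be
  moved to any \<open>x\<close>, at the cost of moving the interval.\<close>

lemma exponential_sum_sup_bound:
  fixes \<xi> :: "nat \<Rightarrow> real"
  assumes L: "0 < L" and x: "x \<in> {m - L/2..m + L/2}"
  shows "(cmod (\<Sum>j<N. c j * cis (\<xi> j * x)))\<^sup>2 * L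
           \<le> 2 * real N * (LINT t:{m - L..m + L}|lborel. (cmod (\<Sum>j<N. c j * cis (\<xi> j * t)))\<^sup>2)"
proof -
  define p where "p x = (\<Sum>j<N. c j * cis (\<xi> j * x))" for x
  have cp: "continuous_on A p" for A
    unfolding p_def by (intro continuous_intros continuous_on_cis_mult)
  \<comment> \<open>Length \<open>L/2\<close> is chosen so that the window
    \<open>{x - y..x - y + L/2}\<close> stays inside \<open>{m - L..m + L}\<close> for every
    admissible \<open>x\<close> and \<open>y\<close>; it is the source of the factor 2.\<close>
  have "\<exists>y\<in>{0..L/2}. \<forall>c. (cmod (\<Sum>j<N. c j * cis (\<xi> j * y)))\<^sup>2 * (L/2 - 0)
           \<le> real N * (LINT t:{0..L/2}|lborel. (cmod (\<Sum>j<N. c j * cis (\<xi> j * t)))\<^sup>2)"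
    by (rule exists_point_evaluation_bound[where e = "\<lambda>j x. cis (\<xi> j * x)"])
      (use L in \<open>auto intro: continuous_on_cis_mult\<close>)
  then obtain y where y: "y \<in> {0..L/2}" and
    ev: "\<And>c. (cmod (\<Sum>j<N. c j * cis (\<xi> j * y)))\<^sup>2 * (L/2 - 0)
           \<le> real N * (LINT t:{0..L/2}|lborel. (cmod (\<Sum>j<N. c j * cis (\<xi> j * t)))\<^sup>2)"
    by blast
  \<comment> \<open>Translation only multiplies each coefficient by a unimodular number. The
    \<open>1 * t\<close> matches the affine substitution rule applied below.\<close>
  have shift: "(\<Sum>j<N. (c j * cis (\<xi> j * (x - y))) * cis (\<xi> j * t)) = p ((x - y) + 1 * t)" for t
    unfolding p_def by (intro sum.cong) (auto simp: cis_mult algebra_simps)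
  have "(LINT t:{0..L/2}|lborel. (cmod (p ((x - y) + 1 * t)))\<^sup>2)
      = (LINT t:{x - y..x - y + L/2}|lborel. (cmod (p t))\<^sup>2)"
  proof -
    have "(x - y) + 1 * t \<in> {x - y..x - y + L/2} \<longleftrightarrow> t \<in> {0..L/2}" for t
      by auto
    then have "indicator {x - y..x - y + L/2} ((x - y) + 1 * t) = (indicator {0..L/2} t :: real)" for t
      unfolding indicator_def by presburger
    then show ?thesis
      unfolding set_lebesgue_integral_def
      using lborel_integral_real_affine[where c = 1 and t = "x - y"
          and f = "\<lambda>t. indicator {x - y..x - y + L/2} t *\<^sub>R (cmod (p t))\<^sup>2"]
      by simp
  qed
  also have "\<dots> \<le> (LINT t:{m - L..m + L}|lborel. (cmod (p t))\<^sup>2)"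
  proof -
    have "{x - y..x - y + L/2} \<subseteq> {m - L..m + L}"
      using x y L by auto
    then have "indicator {x - y..x - y + L/2} t \<le> (indicator {m - L..m + L} t :: real)" for t
      by (auto simp: indicator_def)
    moreover have "set_integrable lborel {c..d} (\<lambda>t. (cmod (p t))\<^sup>2)" for c d
      by (intro borel_integrable_atLeastAtMost' continuous_intros cp)
    ultimately show ?thesis
      unfolding set_lebesgue_integral_def set_integrable_def
      by (intro integral_mono) (auto intro!: mult_right_mono)
  qed
  finally have "real N * (LINT t:{0..L/2}|lborel. (cmod (p ((x - y) + 1 * t)))\<^sup>2)
      \<le> real N * (LINT t:{m - L..m + L}|lborel. (cmod (p t))\<^sup>2)"
    by (intro mult_left_mono) auto
  with ev[of "\<lambda>j. c j * cis (\<xi> j * (x - y))"] have "(cmod (p x))\<^sup>2 * (L/2)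
      \<le> real N * (LINT t:{m - L..m + L}|lborel. (cmod (p t))\<^sup>2)"
    unfolding shift by simp
  then show ?thesis
    unfolding p_def by (simp add: mult_ac)
qed

text \<open>Explicit Riesz representation: with \<open>d i\<close> the pairing of \<open>f\<close>
  with \<open>u i\<close> over \<open>S\<close>, the function
  \<open>h = (\<Sum>i<M. d i * cnj (u i))\<close> has the right moments. Its squared norm
  \<open>D\<close> equals the pairing of \<open>f\<close> with \<open>p\<close>, the conjugate of
  \<open>h\<close>. As \<open>p\<close> lies in the span, the evaluation bound controls it on
  \<open>S\<close>, giving \<open>D * sqrt L \<le> F * sqrt (2 * N * D)\<close> with
  \<open>F\<close> the \<open>L^1\<close> norm of \<open>f\<close> on \<open>S\<close>.\<close>

lemma exponential_moment_representation:
  fixes \<xi> :: "nat \<Rightarrow> real" and f :: "real \<Rightarrow> complex"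
  assumes L: "0 < L" and S: "S \<subseteq> {m - L/2..m + L/2}" and f: "set_integrable lborel S f"
  shows "\<exists>h. continuous_on UNIV h \<and>
      (\<forall>j<N. (LINT x:{m - L..m + L}|lborel. h x * cis (\<xi> j * x)) = (LINT x:S|lborel. f x * cis (\<xi> j * x))) \<and>
      (LINT x:{m - L..m + L}|lborel. (cmod (h x))\<^sup>2) * L
        \<le> 2 * real N * (LINT x:S|lborel. cmod (f x))\<^sup>2"
proof -
  let ?J = "{m - L..m + L}"
  let ?e = "\<lambda>j x. cis (\<xi> j * x)"
  obtain M u where M: "M \<le> N" and o: "orthonormal_on (m - L) (m + L) M u"
    and span1: "\<forall>i<M. \<exists>c. \<forall>x. u i x = (\<Sum>j<N. c j * ?e j x)"
    and span2: "\<forall>j<N. \<exists>c. \<forall>x\<in>?J. ?e j x = (\<Sum>i<M. c i * u i x)"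
    using gram_schmidt[of "m - L" "m + L" N ?e] L continuous_on_cis_mult by auto
  have cu: "continuous_on A (u i)" if i: "i < M" for i A
  proof -
    obtain c where "\<forall>x. u i x = (\<Sum>j<N. c j * ?e j x)"
      using span1 i by blast
    then have "u i = (\<lambda>x. \<Sum>j<N. c j * ?e j x)"
      by (simp add: fun_eq_iff)
    then show ?thesis
      by (simp add: continuous_intros continuous_on_cis_mult)
  qed
  have SJ: "S \<subseteq> ?J"
    using S L by fastforce
  \<comment> \<open>Since \<open>f\<close> is merely integrable, its products are integrable because
    \<open>q\<close> is bounded on the compact interval \<open>?J\<close> containing
    \<open>S\<close>.\<close>
  have fc: "set_integrable lborel S (\<lambda>x. f x * q x)" if q: "continuous_on UNIV q" for q
  proof -
    obtain B where B: "\<And>x. x \<in> ?J \<Longrightarrow> cmod (q x) \<le> B"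
      using compact_imp_bounded[OF compact_continuous_image[OF continuous_on_subset[OF q subset_UNIV] compact_Icc]]
      unfolding bounded_iff by blast
    have "q \<in> borel_measurable borel"
      using q by (rule borel_measurable_continuous_onI)
    moreover have "(\<lambda>x. indicator S x *\<^sub>R f x) \<in> borel_measurable lborel"
      using f unfolding set_integrable_def by auto
    ultimately have "(\<lambda>x. (indicator S x *\<^sub>R f x) * q x) \<in> borel_measurable lborel"
      by (intro borel_measurable_times) auto
    then have meas: "(\<lambda>x. indicator S x *\<^sub>R (f x * q x)) \<in> borel_measurable lborel"
      by simp
    have "integrable lborel (\<lambda>x. B *\<^sub>R (indicator S x *\<^sub>R f x))"
      using f unfolding set_integrable_def by (rule integrable_scaleR_right)
    then show ?thesis
      unfolding set_integrable_def
    proof (rule Bochner_Integration.integrable_bound[OF _ meas], intro AE_I2)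
      fix x
      show "norm (indicator S x *\<^sub>R (f x * q x)) \<le> norm (B *\<^sub>R (indicator S x *\<^sub>R f x))"
      proof (cases "x \<in> S")
        case True
        then have "cmod (q x) \<le> \<bar>B\<bar>"
          using B SJ by (meson abs_ge_self order_trans subsetD)
        then show ?thesis
          using True by (simp add: norm_mult) (metis mult.commute mult_left_mono norm_ge_zero)
      qed auto
    qed
  qed
  define d where "d i = (LINT x:S|lborel. f x * u i x)" for i
  define h where "h x = (\<Sum>i<M. d i * cnj (u i x))" for x
  \<comment> \<open>The moments pair without conjugation, so \<open>h\<close> is the conjugate of an
    element \<open>p\<close> of the span rather than an element itself.\<close>
  define p where "p x = (\<Sum>i<M. cnj (d i) * u i x)" for x
  have ch: "continuous_on A h" and cp: "continuous_on A p" for A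
    unfolding h_def p_def by (intro continuous_intros cu; simp)+
  have p_fun: "p = (\<lambda>x. \<Sum>i<M. cnj (d i) * u i x)"
    by (simp add: p_def fun_eq_iff)
  have hp: "h x = cnj (p x)" for x
    by (simp add: h_def p_def)
  have int_sum: "(LINT x:S|lborel. f x * (\<Sum>i<M. c i * u i x)) = (\<Sum>i<M. c i * d i)" for c
  proof -
    have "set_integrable lborel S (\<lambda>x. f x * (c i * u i x))" if "i < M" for i
      by (intro fc continuous_intros cu that)
    then have "(LINT x:S|lborel. f x * (\<Sum>i<M. c i * u i x))
        = (\<Sum>i<M. LINT x:S|lborel. f x * (c i * u i x))"
      unfolding sum_distrib_left set_lebesgue_integral_def set_integrable_def scaleR_sum_right
      by (intro Bochner_Integration.integral_sum) auto
    also have "\<dots> = (\<Sum>i<M. c i * d i)"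
      unfolding d_def by (simp add: mult.left_commute)
    finally show ?thesis .
  qed
  have moments: "(LINT x:?J|lborel. h x * ?e j x) = (LINT x:S|lborel. f x * ?e j x)" if j: "j < N" for j
  proof -
    obtain c where c: "\<And>x. x \<in> ?J \<Longrightarrow> ?e j x = (\<Sum>i<M. c i * u i x)"
      using span2 j by blast
    have "(LINT x:?J|lborel. h x * ?e j x) = l2_inner (m - L) (m + L) (\<lambda>x. \<Sum>i<M. c i * u i x) p"
      unfolding l2_inner_def
    proof (intro set_lebesgue_integral_cong allI impI)
      fix x assume "x \<in> ?J"
      then have "?e j x = (\<Sum>i<M. c i * u i x)"
        by (rule c)
      then show "h x * ?e j x = (\<Sum>i<M. c i * u i x) * cnj (p x)"
        by (simp add: hp)
    qed simp
    also have "\<dots> = (\<Sum>i<M. c i * l2_inner (m - L) (m + L) (u i) p)"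
      by (intro l2_inner_sum_left cu cp)
    also have "\<dots> = (\<Sum>i<M. c i * d i)"
      by (intro sum.cong refl, subst l2_inner_commute)
        (simp add: p_fun orthonormal_on_inner_sum[OF o])
    also have "\<dots> = (LINT x:S|lborel. f x * (\<Sum>i<M. c i * u i x))"
      by (rule int_sum[symmetric])
    also have "\<dots> = (LINT x:S|lborel. f x * ?e j x)"
      unfolding set_lebesgue_integral_def using c SJ
      by (intro Bochner_Integration.integral_cong) (auto simp: indicator_def)
    finally show ?thesis .
  qed
  define D where "D = (\<Sum>i<M. (cmod (d i))\<^sup>2)"
  have D0: "0 \<le> D" unfolding D_def by (intro sum_nonneg) auto
  have normp: "(LINT x:?J|lborel. (cmod (p x))\<^sup>2) = D"
    unfolding p_def D_def using orthonormal_on_parseval[OF o, of "\<lambda>i. cnj (d i)"] by simp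
  have normh: "(LINT x:?J|lborel. (cmod (h x))\<^sup>2) = D"
    unfolding hp by (simp add: normp)
  \<comment> \<open>Square roots make the bound linear in \<open>cmod (p x)\<close>, ready to be
    integrated against \<open>cmod (f x)\<close>.\<close>
  have pbound: "cmod (p x) * sqrt L \<le> sqrt (2 * real N * D)" if "x \<in> S" for x
  proof -
    obtain c where c: "\<And>x. p x = (\<Sum>j<N. c j * ?e j x)"
      using sum_combination[where N = M and A = UNIV and e = u and M = N and u = ?e and c = "\<lambda>i. cnj (d i)"]
        span1 unfolding p_def by auto
    have "(cmod (p x))\<^sup>2 * L \<le> 2 * real N * D"
      using exponential_sum_sup_bound[OF L subsetD[OF S that], where N = N and c = c and \<xi> = \<xi>, folded c]
      by (simp add: normp)
    then have "sqrt ((cmod (p x))\<^sup>2 * L) \<le> sqrt (2 * real N * D)"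
      by (rule real_sqrt_le_mono)
    then show ?thesis
      by (simp add: real_sqrt_mult)
  qed
  define F where "F = (LINT x:S|lborel. cmod (f x))"
  have "of_real D = (LINT x:S|lborel. f x * p x)"
    unfolding p_def int_sum D_def by (simp add: complex_mult_cnj cmod_power2 mult.commute)
  then have "D = cmod (LINT x:S|lborel. f x * p x)"
    using D0 by (metis norm_of_real abs_of_nonneg)
  also have "\<dots> \<le> (LINT x:S|lborel. cmod (f x * p x))"
    by (intro set_integral_norm_bound fc cp)
  finally have "D * sqrt L \<le> (LINT x:S|lborel. cmod (f x * p x)) * sqrt L"
    using L by (intro mult_right_mono) auto
  also have "\<dots> = (LINT x:S|lborel. cmod (f x) * (cmod (p x) * sqrt L))"
    by (simp add: norm_mult flip: mult.assoc)
  also have "\<dots> \<le> (LINT x:S|lborel. cmod (f x) * sqrt (2 * real N * D))"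
  proof (rule set_integral_mono)
    have "set_integrable lborel S (\<lambda>x. cmod (f x * p x) * sqrt L)"
      by (intro set_integrable_mult_left set_integrable_norm fc cp)
    then show "set_integrable lborel S (\<lambda>x. cmod (f x) * (cmod (p x) * sqrt L))"
      by (simp add: norm_mult mult.assoc)
    show "set_integrable lborel S (\<lambda>x. cmod (f x) * sqrt (2 * real N * D))"
      by (intro set_integrable_mult_left set_integrable_norm f)
    show "cmod (f x) * (cmod (p x) * sqrt L) \<le> cmod (f x) * sqrt (2 * real N * D)" if "x \<in> S" for x
      by (intro mult_left_mono pbound that) auto
  qed
  also have "\<dots> = F * sqrt (2 * real N * D)"
    by (simp add: F_def)
  finally have "(D * sqrt L)\<^sup>2 \<le> (F * sqrt (2 * real N * D))\<^sup>2"
    using D0 L by (intro power_mono) auto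
  then have "D * (D * L) \<le> D * (2 * real N * F\<^sup>2)"
    using D0 L by (simp add: power_mult_distrib power2_eq_square mult_ac)
  \<comment> \<open>One factor \<open>D\<close> is cancelled; when \<open>D = 0\<close> the right
    side is nonnegative anyway.\<close>
  then have "D * L \<le> 2 * real N * F\<^sup>2"
    using D0 by (cases "D = 0") auto
  then show ?thesis
    using ch moments normh unfolding F_def by (intro exI[of _ h]) auto
qed

section \<open>Dyadic stopping intervals\<close>

definition dlen :: "int \<times> int \<Rightarrow> real" where
  "dlen q = 2 powi fst q"

definition dleft :: "int \<times> int \<Rightarrow> real" where
  "dleft q = of_int (snd q) * dlen q"

text \<open>The pair holds scale and position. Integer scales give arbitrarily long and short
  intervals over a countable index type; half-open intervals tile the line at each scale.\<close>

definition dyadic :: "int \<times> int \<Rightarrow> real set" where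
  "dyadic q = {dleft q..<dleft q + dlen q}"

definition dtriple :: "int \<times> int \<Rightarrow> real set" where
  "dtriple q = {dleft q - dlen q..<dleft q + 2 * dlen q}"

text \<open>\<open>div\<close> rounds down, so negative positions also get the interval that
  contains them.\<close>

definition dparent :: "int \<times> int \<Rightarrow> int \<times> int" where
  "dparent q = (fst q + 1, snd q div 2)"

lemma dlen_pos [simp]: "0 < dlen q"
  by (simp add: dlen_def)

lemma dlen_nonneg [simp]: "0 \<le> dlen q"
  by (simp add: dlen_def)

lemma dlen_parent [simp]: "dlen (dparent q) = 2 * dlen q"
  by (simp add: dlen_def dparent_def power_int_add)

lemma dyadic_borel [measurable, simp]: "dyadic q \<in> sets borel" "dtriple q \<in> sets borel"
  by (simp_all add: dyadic_def dtriple_def)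

lemma emeasure_dyadic [simp]: "emeasure lborel (dyadic q) = ennreal (dlen q)"
  by (simp add: dyadic_def)

lemma emeasure_dtriple: "emeasure lborel (dtriple q) = ennreal (3 * dlen q)"
  using dlen_pos[of q] by (simp add: dtriple_def)

lemma dyadic_subset_dtriple: "dyadic q \<subseteq> dtriple q"
  unfolding dyadic_def dtriple_def using dlen_pos[of q] by auto

lemma dleft_in_dyadic: "dleft q \<in> dyadic q"
  by (simp add: dyadic_def)

text \<open>In units of the shorter length \<open>t\<close>, the endpoints of both intervals are
  integers. Overlap gives strict inequalities between integers, which improve by one unit to
  containment.\<close>

lemma dyadic_nested:
  assumes "fst q \<le> fst r" "dyadic q \<inter> dyadic r \<noteq> {}"
  shows "dyadic q \<subseteq> dyadic r"
proof -
  obtain n k m l where q: "q = (n, k)" and r: "r = (m, l)"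
    by (metis surj_pair)
  define D :: int where "D = 2 ^ nat (m - n)"
  define t :: real where "t = 2 powi n"
  have t: "0 < t" by (simp add: t_def)
  have m: "m = n + int (nat (m - n))"
    using assms(1) q r by simp
  have "(2::real) powi (n + int (nat (m - n))) = 2 powi n * 2 ^ nat (m - n)"
    by (subst power_int_add) (simp_all only: power_int_of_nat, simp)
  then have mt: "2 powi m = of_int D * t"
    unfolding m[symmetric] by (simp add: D_def t_def)
  obtain x where "x \<in> dyadic q" "x \<in> dyadic r"
    using assms(2) by blast
  then have x: "of_int k * t \<le> x" "x < of_int k * t + t"
    "of_int l * (of_int D * t) \<le> x" "x < of_int l * (of_int D * t) + of_int D * t"
    by (auto simp: dyadic_def dleft_def dlen_def q r mt simp flip: t_def)
  have "of_int k * t < of_int ((l + 1) * D) * t"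
    using x by (simp add: algebra_simps)
  then have k1: "k + 1 \<le> (l + 1) * D"
    using t by (simp only: mult_less_cancel_right_pos of_int_less_iff)
  have "of_int (l * D) * t < of_int (k + 1) * t"
    using x by (simp add: algebra_simps)
  then have k2: "l * D \<le> k"
    using t by (simp only: mult_less_cancel_right_pos of_int_less_iff)
  have "of_int (k + 1) * t \<le> of_int ((l + 1) * D) * t" "of_int (l * D) * t \<le> of_int k * t"
    using t k1 k2 by (simp_all only: mult_le_cancel_right_pos of_int_le_iff)
  then show ?thesis
    by (auto simp: dyadic_def dleft_def dlen_def q r mt algebra_simps simp flip: t_def)
qed

lemma dyadic_disjoint_or_eq:
  assumes "fst q = fst r" "dyadic q \<inter> dyadic r \<noteq> {}"
  shows "q = r"
proof -
  have "dyadic q \<subseteq> dyadic r" "dyadic r \<subseteq> dyadic q"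
    using assms dyadic_nested[of q r] dyadic_nested[of r q] by auto
  then have "dleft q = dleft r"
    using dlen_pos[of q] dlen_pos[of r] by (auto simp: dyadic_def simp del: dlen_pos)
  moreover have "dlen q = dlen r"
    using assms(1) by (simp add: dlen_def)
  ultimately have "snd q = snd r"
    using dlen_pos[of r] by (auto simp: dleft_def)
  with assms(1) show ?thesis
    by (simp add: prod_eq_iff)
qed

lemma dyadic_subset_dparent: "dyadic q \<subseteq> dyadic (dparent q)"
proof -
  define j where "j = snd q div 2"
  have "2 * j \<le> snd q" "snd q + 1 \<le> 2 * j + 2"
    unfolding j_def by linarith+
  then have "of_int (2 * j) * dlen q \<le> of_int (snd q) * dlen q"
    "of_int (snd q + 1) * dlen q \<le> of_int (2 * j + 2) * dlen q"
    using dlen_pos[of q] by (simp_all only: mult_le_cancel_right_pos of_int_le_iff)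
  moreover have "dleft (dparent q) = of_int (2 * j) * dlen q"
    "dleft (dparent q) + dlen (dparent q) = of_int (2 * j + 2) * dlen q"
    unfolding dleft_def dlen_parent by (simp_all add: dparent_def j_def algebra_simps)
  ultimately show ?thesis
    by (auto simp: dyadic_def dleft_def algebra_simps)
qed

lemma dyadic_mono_bounds:
  assumes "dyadic q \<subseteq> dyadic r"
  shows "dleft r \<le> dleft q" "dleft q + dlen q \<le> dleft r + dlen r" "dlen q \<le> dlen r"
proof -
  have "dleft r \<le> dleft q \<and> dleft q + dlen q \<le> dleft r + dlen r"
    using assms dlen_pos[of q] unfolding dyadic_def
    by (simp add: ivl_subset)
  then show "dleft r \<le> dleft q" "dleft q + dlen q \<le> dleft r + dlen r" "dlen q \<le> dlen r"
    by auto
qed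

lemma dtriple_mono: "dyadic q \<subseteq> dyadic r \<Longrightarrow> dtriple q \<subseteq> dtriple r"
  using dyadic_mono_bounds[of q r] by (auto simp: dtriple_def)

definition dyadic_at :: "int \<Rightarrow> real \<Rightarrow> int \<times> int" where
  "dyadic_at n x = (n, \<lfloor>x / 2 powi n\<rfloor>)"

lemma mem_dyadic_at: "x \<in> dyadic (dyadic_at n x)"
proof -
  have "of_int \<lfloor>x / 2 powi n\<rfloor> \<le> x / 2 powi n" "x / 2 powi n < of_int \<lfloor>x / 2 powi n\<rfloor> + 1"
    by linarith+
  then have "of_int \<lfloor>x / 2 powi n\<rfloor> * 2 powi n \<le> x" "x < (of_int \<lfloor>x / 2 powi n\<rfloor> + 1) * 2 powi n"
    by (simp_all only: pos_le_divide_eq pos_divide_less_eq zero_less_power_int zero_less_numeral)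
  then show ?thesis
    by (auto simp: dyadic_def dleft_def dlen_def dyadic_at_def distrib_right)
qed

lemma dlen_dyadic_at [simp]: "dlen (dyadic_at n x) = 2 powi n"
  by (simp add: dlen_def dyadic_at_def)

text \<open>The cap \<open>fst q \<le> 0\<close> guarantees maximal intervals even when
  \<open>U\<close> contains arbitrarily long ones.\<close>

lemma exists_small_dyadic:
  assumes "open U" "x \<in> U"
  shows "\<exists>q. x \<in> dyadic q \<and> dyadic q \<subseteq> U \<and> fst q \<le> 0"
proof -
  obtain e where e: "e > 0" "ball x e \<subseteq> U"
    using assms open_contains_ball by blast
  obtain n where n: "(1/2::real) ^ n < e"
    using real_arch_pow_inv[OF e(1), of "1/2"] by auto
  let ?q = "dyadic_at (- int n) x"
  have len: "dlen ?q < e"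
    using n by (simp add: power_int_minus power_one_over inverse_eq_divide)
  have "dyadic ?q \<subseteq> ball x e"
    using mem_dyadic_at[of x "- int n"] len by (auto simp: dyadic_def dist_real_def)
  then show ?thesis
    using e(2) mem_dyadic_at[of x "- int n"]
    by (intro exI[of _ ?q]) (auto simp: dyadic_at_def)
qed

lemma dlen_le_imp_scale_bound: "\<exists>n0. \<forall>q. dlen q \<le> c \<longrightarrow> fst q \<le> n0"
proof -
  obtain m where m: "c < (2::real) ^ m"
    using real_arch_pow[of 2 c] by auto
  have "fst q \<le> int m" if "dlen q \<le> c" for q
  proof (rule ccontr)
    assume "\<not> fst q \<le> int m"
    then have "(2::real) powi int m \<le> 2 powi fst q"
      by (intro power_int_increasing) auto
    then show False
      using m that by (simp add: dlen_def)
  qed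
  then show ?thesis by blast
qed

section \<open>Maximal intervals of a family\<close>

definition maximal_dyadic :: "(int \<times> int) set \<Rightarrow> (int \<times> int) set" where
  "maximal_dyadic B = {q \<in> B. \<forall>r\<in>B. fst q < fst r \<longrightarrow> dyadic q \<inter> dyadic r = {}}"

lemma maximal_dyadic_subset: "maximal_dyadic B \<subseteq> B"
  by (auto simp: maximal_dyadic_def)

text \<open>By nesting, maximality under inclusion is the same as missing every longer member of the
  family. In that form different scales are disjoint at once, and equal scales are disjoint by the
  grid structure.\<close>

lemma disjoint_maximal_dyadic: "disjoint_family_on dyadic (maximal_dyadic B)"
  unfolding disjoint_family_on_def
proof (intro ballI impI)
  fix q r assume "q \<in> maximal_dyadic B" "r \<in> maximal_dyadic B" "q \<noteq> r"
  then show "dyadic q \<inter> dyadic r = {}"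
    using dyadic_disjoint_or_eq[of q r]
    unfolding maximal_dyadic_def by (cases "fst q" "fst r" rule: linorder_cases) auto
qed

lemma dparent_notin_if_maximal: "q \<in> maximal_dyadic B \<Longrightarrow> dparent q \<notin> B"
proof
  assume "q \<in> maximal_dyadic B" "dparent q \<in> B"
  then have "dyadic q \<inter> dyadic (dparent q) = {}"
    by (auto simp: maximal_dyadic_def dparent_def)
  then show False
    using dyadic_subset_dparent[of q] dleft_in_dyadic[of q] by blast
qed

text \<open>Among the members containing \<open>dyadic q\<close>, take one of largest scale; the
  bound \<open>n0\<close> turns this into a least natural number. A longer member meeting it would
  contain it by nesting.\<close>

lemma exists_maximal_dyadic:
  assumes "\<And>q. q \<in> B \<Longrightarrow> fst q \<le> n0" "q \<in> B"
  shows "\<exists>r\<in>maximal_dyadic B. dyadic q \<subseteq> dyadic r"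
proof -
  let ?P = "\<lambda>r. r \<in> B \<and> dyadic q \<subseteq> dyadic r"
  obtain r where r: "?P r" and least: "\<And>s. ?P s \<Longrightarrow> nat (n0 - fst r) \<le> nat (n0 - fst s)"
    using ex_has_least_nat[of ?P q "\<lambda>r. nat (n0 - fst r)"] assms(2) by blast
  have "dyadic r \<inter> dyadic s = {}" if s: "s \<in> B" "fst r < fst s" for s
  proof (rule ccontr)
    assume "dyadic r \<inter> dyadic s \<noteq> {}"
    then have "?P s"
      using s r dyadic_nested[of r s] by auto
    from least[OF this] show False
      using s assms(1)[OF s(1)] by auto
  qed
  then show ?thesis
    using r by (intro bexI[of _ r]) (auto simp: maximal_dyadic_def)
qed

text \<open>Exhaust the index set by finite sets along \<open>to_nat\<close>, and use finite
  subadditivity and continuity from below.\<close>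

lemma emeasure_UN_le_finite_sums:
  fixes A :: "'i::countable \<Rightarrow> 'a set"
  assumes A: "\<And>i. i \<in> I \<Longrightarrow> A i \<in> sets M"
    and le: "\<And>T. finite T \<Longrightarrow> T \<subseteq> I \<Longrightarrow> (\<Sum>i\<in>T. emeasure M (A i)) \<le> c"
  shows "emeasure M (\<Union>i\<in>I. A i) \<le> c"
proof -
  define T where "T n = {i \<in> I. to_nat i \<le> n}" for n
  have fin: "finite (T n)" for n
  proof -
    have "finite (to_nat ` T n)"
      by (rule finite_subset[of _ "{..n}"]) (auto simp: T_def)
    then show ?thesis
      by (rule finite_imageD) (auto intro: inj_onI)
  qed
  have inc: "incseq (\<lambda>n. \<Union>i\<in>T n. A i)"
    unfolding incseq_def by (intro allI impI UN_mono) (auto simp: T_def)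
  have eq: "(\<Union>i\<in>I. A i) = (\<Union>n. \<Union>i\<in>T n. A i)"
    by (auto simp: T_def)
  have "emeasure M (\<Union>n. \<Union>i\<in>T n. A i) = (SUP n. emeasure M (\<Union>i\<in>T n. A i))"
    by (rule SUP_emeasure_incseq[symmetric])
      (use inc fin A in \<open>auto simp: T_def intro!: sets.finite_UN\<close>)
  also have "\<dots> \<le> c"
  proof (rule SUP_least)
    fix n
    have "emeasure M (\<Union>i\<in>T n. A i) \<le> (\<Sum>i\<in>T n. emeasure M (A i))"
      by (rule emeasure_subadditive_finite) (use fin A in \<open>auto simp: T_def\<close>)
    also have "\<dots> \<le> c"
      by (rule le) (use fin in \<open>auto simp: T_def\<close>)
    finally show "emeasure M (\<Union>i\<in>T n. A i) \<le> c" .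
  qed
  finally show ?thesis
    using eq by simp
qed

section \<open>Heavy intervals: weak-type bound and differentiation\<close>

definition heavy_dyadic :: "(real \<Rightarrow> real) \<Rightarrow> real \<Rightarrow> (int \<times> int) set" where
  "heavy_dyadic F c = {q. c * dlen q < (LINT x:dyadic q|lborel. F x)}"

context
  fixes F :: "real \<Rightarrow> real" and c :: real
  assumes F: "integrable lborel F" and F0: "\<And>x. 0 \<le> F x" and c: "0 < c"
begin

lemma set_integrable_F: "A \<in> sets borel \<Longrightarrow> set_integrable lborel A F"
  unfolding set_integrable_def using F by (intro integrable_mult_indicator) auto

lemma set_integral_le_integral_F: "A \<in> sets borel \<Longrightarrow> (LINT x:A|lborel. F x) \<le> (LINT x|lborel. F x)"
  unfolding set_lebesgue_integral_def
  using set_integrable_F[of A] F F0 unfolding set_integrable_def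
  by (intro integral_mono) (auto simp: indicator_def)

lemma heavy_dyadic_len_le: "q \<in> heavy_dyadic F c \<Longrightarrow> dlen q \<le> (LINT x|lborel. F x) / c"
  using set_integral_le_integral_F[of "dyadic q"] c
  by (auto simp: heavy_dyadic_def field_simps)

lemma sum_dlen_maximal_heavy_le:
  assumes T: "finite T" "T \<subseteq> maximal_dyadic (heavy_dyadic F c)"
  shows "(\<Sum>q\<in>T. dlen q) \<le> (LINT x|lborel. F x) / c"
proof -
  have "c * (\<Sum>q\<in>T. dlen q) \<le> (\<Sum>q\<in>T. LINT x:dyadic q|lborel. F x)"
    unfolding sum_distrib_left using T maximal_dyadic_subset
    by (intro sum_mono) (force simp: heavy_dyadic_def)
  also have "\<dots> = (LINT x:(\<Union>q\<in>T. dyadic q)|lborel. F x)"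
    using T disjoint_family_on_mono[OF T(2) disjoint_maximal_dyadic]
    by (intro set_integral_finite_Union[symmetric] set_integrable_F) auto
  also have "\<dots> \<le> (LINT x|lborel. F x)"
    by (intro set_integral_le_integral_F sets.finite_UN) (use T in auto)
  finally show ?thesis
    using c by (simp add: field_simps)
qed

text \<open>A weak-type (1,1) estimate. Heavy intervals have bounded length, so each lies in a
  maximal one and its triple in the triple of that one; the maximal ones are disjoint and each
  carries more than \<open>c\<close> times its length of the integral of \<open>F\<close>.\<close>

lemma emeasure_UN_dtriple_heavy_le:
  "emeasure lborel (\<Union>q\<in>heavy_dyadic F c. dtriple q) \<le> ennreal (3 * (LINT x|lborel. F x) / c)"
proof -
  let ?B = "heavy_dyadic F c"
  obtain n0 where n0: "\<And>q. q \<in> ?B \<Longrightarrow> fst q \<le> n0"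
    using dlen_le_imp_scale_bound heavy_dyadic_len_le by meson
  have "\<exists>r\<in>maximal_dyadic ?B. dtriple q \<subseteq> dtriple r" if "q \<in> ?B" for q
    using exists_maximal_dyadic[of ?B n0, OF n0 that] dtriple_mono by blast
  then have sub: "(\<Union>q\<in>?B. dtriple q) \<subseteq> (\<Union>q\<in>maximal_dyadic ?B. dtriple q)"
    by blast
  have "emeasure lborel (\<Union>q\<in>?B. dtriple q) \<le> emeasure lborel (\<Union>q\<in>maximal_dyadic ?B. dtriple q)"
    by (rule emeasure_mono[OF sub]) (auto intro!: sets.countable_UN')
  also have "\<dots> \<le> ennreal (3 * (LINT x|lborel. F x) / c)"
  proof (rule emeasure_UN_le_finite_sums)
    fix T assume T: "finite T" "T \<subseteq> maximal_dyadic ?B"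
    have "(\<Sum>q\<in>T. emeasure lborel (dtriple q)) = ennreal (3 * (\<Sum>q\<in>T. dlen q))"
      unfolding emeasure_dtriple by (simp add: sum_distrib_left)
    also have "\<dots> \<le> ennreal (3 * (LINT x|lborel. F x) / c)"
      using sum_dlen_maximal_heavy_le[OF T] by (intro ennreal_leI) simp
    finally show "(\<Sum>q\<in>T. emeasure lborel (dtriple q)) \<le> ennreal (3 * (LINT x|lborel. F x) / c)" .
  qed auto
  finally show ?thesis .
qed

text \<open>If \<open>F > c\<close> on \<open>A \<subseteq> E\<close>, cover \<open>A\<close> by disjoint dyadic intervals inside a tight open
  neighbourhood; the hypothesis applies to those that meet \<open>A\<close> and gives \<open>\<integral>\<^sub>A F \<le> c |A|\<close>.\<close>

lemma AE_le_if_dyadic_averages_le: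
  assumes E: "E \<in> sets borel"
    and avg: "\<And>q. dyadic q \<inter> E \<noteq> {} \<Longrightarrow> (LINT x:dyadic q|lborel. F x) \<le> c * dlen q"
  shows "AE x in lborel. x \<in> E \<longrightarrow> F x \<le> c"
proof -
  have Fm [measurable]: "F \<in> borel_measurable borel"
    using F by auto
  define A where "A = {x \<in> E. c < F x}"
  have A [measurable]: "A \<in> sets borel"
    unfolding A_def using E by measurable
  define \<nu> where "\<nu> = density lborel (\<lambda>x. ennreal (F x))"
  have [measurable_cong, simp]: "sets \<nu> = sets borel"
    by (simp add: \<nu>_def)
  have nu_q: "emeasure \<nu> (dyadic q) = ennreal (LINT x:dyadic q|lborel. F x)" for q
    using nn_integral_eq_integral[OF set_integrable_F[of "dyadic q", unfolded set_integrable_def]] F0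
    by (simp add: \<nu>_def emeasure_density set_lebesgue_integral_def mult.commute
        flip: ennreal_mult' ennreal_indicator)
  have nu_A: "ennreal c * emeasure lborel A \<le> emeasure \<nu> A"
  proof -
    have "ennreal c * emeasure lborel A = (\<integral>\<^sup>+x. ennreal c * indicator A x \<partial>lborel)"
      by (simp add: nn_integral_cmult_indicator)
    also have "\<dots> \<le> (\<integral>\<^sup>+x. ennreal (F x) * indicator A x \<partial>lborel)"
      by (intro nn_integral_mono) (auto simp: A_def indicator_def intro: ennreal_leI)
    finally show ?thesis
      by (simp add: \<nu>_def emeasure_density)
  qed
  have fin_nu: "emeasure \<nu> X \<le> ennreal (LINT x|lborel. F x)" if [measurable]: "X \<in> sets borel" for X
  proof -
    have "emeasure \<nu> X \<le> (\<integral>\<^sup>+x. ennreal (F x) \<partial>lborel)"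
      unfolding \<nu>_def by (subst emeasure_density) (auto intro!: nn_integral_mono simp: indicator_def)
    then show ?thesis
      using nn_integral_eq_integral[OF F] F0 by simp
  qed
  \<comment> \<open>Finiteness, a Chebyshev bound, is what later permits cancelling
    \<open>ennreal c * emeasure lborel A\<close>.\<close>
  have finA: "emeasure lborel A < \<infinity>"
  proof -
    have "ennreal c * emeasure lborel A < \<infinity>"
      using order.strict_trans1[OF order.trans[OF nu_A fin_nu[OF A]] ennreal_less_top] by simp
    then show ?thesis
      using c by (auto simp: ennreal_mult_less_top)
  qed
  have upper: "emeasure \<nu> A \<le> ennreal c * emeasure lborel A + ennreal (c * e)" if e: "0 < e" for e
  proof -
    obtain U where U: "open U" "A \<subseteq> U" "emeasure lborel (U - A) < ennreal e"
      using outer_regular_lborel[OF A e] by auto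
    define D where "D = {q. dyadic q \<subseteq> U \<and> fst q \<le> 0}"
    define M where "M = {q \<in> maximal_dyadic D. dyadic q \<inter> A \<noteq> {}}"
    have MD: "M \<subseteq> maximal_dyadic D"
      by (auto simp: M_def)
    have disj: "disjoint_family_on dyadic M"
      by (rule disjoint_family_on_mono[OF MD disjoint_maximal_dyadic])
    have cover: "A \<subseteq> (\<Union>q\<in>M. dyadic q)"
    proof
      fix x assume x: "x \<in> A"
      then obtain q where q: "x \<in> dyadic q" "q \<in> D"
        using exists_small_dyadic[of U x] U unfolding D_def by blast
      then obtain r where "r \<in> maximal_dyadic D" "dyadic q \<subseteq> dyadic r"
        using exists_maximal_dyadic[of D 0 q] by (auto simp: D_def)
      then show "x \<in> (\<Union>q\<in>M. dyadic q)"
        using q x unfolding M_def by blast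
    qed
    have cntM: "countable M" by (rule countableI_type)
    have le_q: "emeasure \<nu> (dyadic q) \<le> ennreal c * emeasure lborel (dyadic q)" if "q \<in> M" for q
    proof -
      have "(LINT x:dyadic q|lborel. F x) \<le> c * dlen q"
        using that by (intro avg) (auto simp: M_def A_def)
      then show ?thesis
        unfolding nu_q using c by (simp add: ennreal_leI flip: ennreal_mult)
    qed
    have "emeasure \<nu> A \<le> emeasure \<nu> (\<Union>q\<in>M. dyadic q)"
      by (intro emeasure_mono cover) (auto intro!: sets.countable_UN')
    also have "\<dots> = (\<integral>\<^sup>+q. emeasure \<nu> (dyadic q) \<partial>count_space M)"
      by (intro emeasure_UN_countable cntM disj) auto
    also have "\<dots> \<le> (\<integral>\<^sup>+q. ennreal c * emeasure lborel (dyadic q) \<partial>count_space M)"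
      using le_q by (intro nn_integral_mono) auto
    also have "\<dots> = ennreal c * (\<integral>\<^sup>+q. emeasure lborel (dyadic q) \<partial>count_space M)"
      by (intro nn_integral_cmult) auto
    also have "(\<integral>\<^sup>+q. emeasure lborel (dyadic q) \<partial>count_space M) = emeasure lborel (\<Union>q\<in>M. dyadic q)"
      by (intro emeasure_UN_countable[symmetric] cntM disj) auto
    also have "\<dots> \<le> emeasure lborel (A \<union> (U - A))"
      using MD maximal_dyadic_subset[of D] U by (intro emeasure_mono) (auto simp: D_def)
    also have "\<dots> \<le> emeasure lborel A + emeasure lborel (U - A)"
      by (intro emeasure_subadditive) (use U in auto)
    also have "\<dots> \<le> emeasure lborel A + ennreal e"
      using U by (intro add_left_mono) auto
    finally have "emeasure \<nu> A \<le> ennreal c * (emeasure lborel A + ennreal e)"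
      by (simp add: mult_left_mono)
    then show ?thesis
      using c e by (simp add: distrib_left ennreal_mult)
  qed
  have "emeasure \<nu> A \<le> ennreal c * emeasure lborel A"
  proof (rule ennreal_le_epsilon)
    fix e :: real assume "0 < e"
    then show "emeasure \<nu> A \<le> ennreal c * emeasure lborel A + ennreal e"
      using upper[of "e / c"] c by simp
  qed
  with nu_A have eq: "emeasure \<nu> A = ennreal c * emeasure lborel A"
    by (rule antisym[rotated])
  \<comment> \<open>Equality leaves no excess: \<open>F - c\<close> is positive on \<open>A\<close>
    yet integrates to zero there, so \<open>A\<close> is null.\<close>
  have "(\<integral>\<^sup>+x. ennreal (F x - c) * indicator A x \<partial>lborel) = 0"
  proof -
    have "(\<integral>\<^sup>+x. ennreal (F x) * indicator A x \<partial>lborel)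
        = (\<integral>\<^sup>+x. ennreal (F x - c) * indicator A x + ennreal c * indicator A x \<partial>lborel)"
      using c by (intro nn_integral_cong) (auto simp: A_def indicator_def simp flip: ennreal_plus)
    also have "\<dots> = (\<integral>\<^sup>+x. ennreal (F x - c) * indicator A x \<partial>lborel) + ennreal c * emeasure lborel A"
      by (subst nn_integral_add) (auto simp: nn_integral_cmult_indicator)
    finally have "ennreal c * emeasure lborel A + 0 = ennreal c * emeasure lborel A
        + (\<integral>\<^sup>+x. ennreal (F x - c) * indicator A x \<partial>lborel)"
      using eq by (simp add: \<nu>_def emeasure_density add.commute)
    moreover have "ennreal c * emeasure lborel A \<noteq> \<infinity>"
      using finA by (auto simp: ennreal_mult_eq_top_iff)
    ultimately show ?thesis
      by (simp only: ennreal_add_left_cancel) auto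
  qed
  then have "AE x in lborel. ennreal (F x - c) * indicator A x = 0"
    by (subst (asm) nn_integral_0_iff_AE) auto
  then show ?thesis
    by (rule AE_mp) (auto intro!: AE_I2 simp: A_def indicator_def ennreal_eq_0_iff)
qed

end

section \<open>Whitney intervals and the overlap of their doubles\<close>

text \<open>The triple condition keeps an interval at least its own length away from the complement
  of \<open>\<Omega>\<close>, and maximality makes the parent fail this. So lengths are comparable
  to the distance from the complement.\<close>

definition whitney :: "real set \<Rightarrow> (int \<times> int) set" where
  "whitney \<Omega> = maximal_dyadic {q. dtriple q \<subseteq> \<Omega>}"

lemma dtriple_subset_if_whitney: "q \<in> whitney \<Omega> \<Longrightarrow> dtriple q \<subseteq> \<Omega>"
  using maximal_dyadic_subset by (auto simp: whitney_def)

text \<open>Finite measure bounds the length of any interval whose triple fits into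
  \<open>\<Omega>\<close>; this is what makes maximal ones exist.\<close>

lemma whitney_scale_bound:
  assumes "\<Omega> \<in> sets borel" "emeasure lborel \<Omega> < \<infinity>"
  shows "\<exists>n0. \<forall>q. dtriple q \<subseteq> \<Omega> \<longrightarrow> fst q \<le> n0"
proof -
  have "dlen q \<le> measure lborel \<Omega>" if "dtriple q \<subseteq> \<Omega>" for q
  proof -
    have "ennreal (3 * dlen q) \<le> emeasure lborel \<Omega>"
      unfolding emeasure_dtriple[symmetric] using that assms by (intro emeasure_mono) auto
    also have "\<dots> = ennreal (measure lborel \<Omega>)"
      using assms by (intro emeasure_eq_ennreal_measure) auto
    finally show ?thesis
      using dlen_nonneg[of q] by (simp add: ennreal_le_iff del: dlen_nonneg)
  qed
  then show ?thesis
    using dlen_le_imp_scale_bound[of "measure lborel \<Omega>"] by blast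
qed

lemma exists_whitney_superset:
  assumes "\<Omega> \<in> sets borel" "emeasure lborel \<Omega> < \<infinity>" "dtriple q \<subseteq> \<Omega>"
  shows "\<exists>r\<in>whitney \<Omega>. dyadic q \<subseteq> dyadic r"
proof -
  obtain n0 where "\<And>q. dtriple q \<subseteq> \<Omega> \<Longrightarrow> fst q \<le> n0"
    using whitney_scale_bound[OF assms(1,2)] by blast
  then show ?thesis
    using exists_maximal_dyadic[of "{q. dtriple q \<subseteq> \<Omega>}" n0 q] assms(3)
    unfolding whitney_def by auto
qed

lemma sum_dlen_whitney_le:
  assumes "\<Omega> \<in> sets borel" "finite T" "T \<subseteq> whitney \<Omega>"
  shows "ennreal (\<Sum>q\<in>T. dlen q) \<le> emeasure lborel \<Omega>"
proof -
  have "ennreal (\<Sum>q\<in>T. dlen q) = (\<Sum>q\<in>T. emeasure lborel (dyadic q))"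
    by simp
  also have "\<dots> = emeasure lborel (\<Union>q\<in>T. dyadic q)"
    using assms disjoint_family_on_mono[OF assms(3)[unfolded whitney_def] disjoint_maximal_dyadic]
    by (intro sum_emeasure) auto
  also have "\<dots> \<le> emeasure lborel \<Omega>"
    using assms dtriple_subset_if_whitney dyadic_subset_dtriple by (intro emeasure_mono) (blast, simp)
  finally show ?thesis .
qed

text \<open>The margin \<open>dlen q / 2\<close> left between the double and the ends of
  \<open>dtriple q\<close> is what forces intersecting doubles to have comparable scales.\<close>

definition ddouble :: "int \<times> int \<Rightarrow> real set" where
  "ddouble q = {dleft q - dlen q / 2..dleft q + 3/2 * dlen q}"

text \<open>If a Whitney interval \<open>r\<close> were much shorter than \<open>q\<close> and their doubles met, the triple of
  the parent of \<open>r\<close> would lie in the triple of \<open>q\<close>, contradicting maximality of \<open>r\<close>.\<close>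

lemma whitney_scales_comparable:
  assumes "q \<in> whitney \<Omega>" "r \<in> whitney \<Omega>" "z \<in> ddouble q" "z \<in> ddouble r"
  shows "fst q \<le> fst r + 3"
proof (rule ccontr)
  assume "\<not> fst q \<le> fst r + 3"
  \<comment> \<open>Four scales give a ratio 16. The triple of the parent of \<open>r\<close>
    reaches at most \<open>9/2 * dlen r\<close> from \<open>z\<close>, while \<open>z\<close> has
    margin \<open>dlen q / 2 \<ge> 8 * dlen r\<close> inside \<open>dtriple q\<close>.\<close>
  then have "(2::real) powi (fst r + 4) \<le> 2 powi fst q"
    by (intro power_int_increasing) auto
  then have len: "16 * dlen r \<le> dlen q"
    by (simp add: dlen_def power_int_add)
  have "dleft (dparent r) \<le> dleft r" "dleft r + dlen r \<le> dleft (dparent r) + 2 * dlen r"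
    using dyadic_mono_bounds[OF dyadic_subset_dparent[of r]] by auto
  then have "dtriple (dparent r) \<subseteq> dtriple q"
    using len dlen_pos[of r] assms(3,4) by (auto simp: dtriple_def ddouble_def)
  then have "dparent r \<in> {q. dtriple q \<subseteq> \<Omega>}"
    using dtriple_subset_if_whitney[OF assms(1)] by auto
  then show False
    using dparent_notin_if_maximal assms(2) unfolding whitney_def by blast
qed

text \<open>The count is 7 times 3: all scales lie within 3 of that of a fixed member, and at each
  scale \<open>z\<close> determines the position up to three choices.\<close>

lemma whitney_overlap:
  shows "finite {q \<in> whitney \<Omega>. z \<in> ddouble q}" "card {q \<in> whitney \<Omega>. z \<in> ddouble q} \<le> 21"
proof -
  let ?Q = "{q \<in> whitney \<Omega>. z \<in> ddouble q}"
  have "finite ?Q \<and> card ?Q \<le> 21"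
  proof (cases "?Q = {}")
    case False
    then obtain q0 where q0: "q0 \<in> ?Q" by blast
    define K where "K n = {\<lfloor>z / 2 powi n\<rfloor> - 1..\<lfloor>z / 2 powi n\<rfloor> + 1}" for n :: int
    have "?Q \<subseteq> Sigma {fst q0 - 3..fst q0 + 3} K"
    proof
      fix q assume q: "q \<in> ?Q"
      have "fst q \<le> fst q0 + 3" "fst q0 \<le> fst q + 3"
        using q q0 whitney_scales_comparable by blast+
      moreover have "snd q \<in> K (fst q)"
      proof -
        have "(of_int (snd q) - 1/2) * dlen q \<le> z" "z \<le> (of_int (snd q) + 3/2) * dlen q"
          using q by (auto simp: ddouble_def dleft_def algebra_simps)
        then have "of_int (snd q) - 1/2 \<le> z / dlen q" "z / dlen q \<le> of_int (snd q) + 3/2"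
          by (simp_all add: pos_le_divide_eq pos_divide_le_eq)
        then show ?thesis
          unfolding K_def dlen_def by (auto; linarith)
      qed
      ultimately show "q \<in> Sigma {fst q0 - 3..fst q0 + 3} K"
        by (auto simp: mem_Sigma_iff intro: SigmaI[of "fst q" _ "snd q", simplified])
    qed
    moreover have "finite (Sigma {fst q0 - 3..fst q0 + 3} K)"
      by (auto simp: K_def)
    moreover have "card (Sigma {fst q0 - 3..fst q0 + 3} K) = 21"
      by (subst card_SigmaI) (auto simp: K_def)
    ultimately show ?thesis
      by (metis card_mono finite_subset)
  next
    case True
    then show ?thesis by (simp only:) simp
  qed
  then show "finite ?Q" "card ?Q \<le> 21" by auto
qed

section \<open>The decomposition\<close>

text \<open>At most \<open>K\<close> terms are nonzero at a point, so Cauchy-Schwarz costs a factor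
  \<open>K\<close> for each finite partial sum. The partial sums along \<open>to_nat\<close> are
  eventually constant at each point, and Fatou's lemma carries the bound to
  \<open>G\<close>.\<close>

lemma square_integral_finite_overlap_sum:
  fixes H :: "'i::countable \<Rightarrow> 'a \<Rightarrow> complex"
  assumes meas [measurable]: "\<And>i. H i \<in> borel_measurable M"
    and fin: "\<And>x. finite {i. H i x \<noteq> 0}" and card: "\<And>x. card {i. H i x \<noteq> 0} \<le> K"
    and int: "\<And>i. integrable M (\<lambda>x. (cmod (H i x))\<^sup>2)"
    and bound: "\<And>T. finite T \<Longrightarrow> (\<Sum>i\<in>T. LINT x|M. (cmod (H i x))\<^sup>2) \<le> c"
  defines "G \<equiv> \<lambda>x. \<Sum>i | H i x \<noteq> 0. H i x"
  shows "G \<in> borel_measurable M" "integrable M (\<lambda>x. (cmod (G x))\<^sup>2)"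
    "(LINT x|M. (cmod (G x))\<^sup>2) \<le> real K * c"
proof -
  define T where "T n = {i::'i. to_nat i \<le> n}" for n
  have finT: "finite (T n)" for n
  proof -
    have "finite (to_nat ` T n)"
      by (rule finite_subset[of _ "{..n}"]) (auto simp: T_def)
    then show ?thesis
      by (rule finite_imageD) (auto intro: inj_onI)
  qed
  define Gn where "Gn n x = (\<Sum>i\<in>T n. H i x)" for n x
  have [measurable]: "Gn n \<in> borel_measurable M" for n
    unfolding Gn_def by measurable
  have lim: "(\<lambda>n. Gn n x) \<longlonglongrightarrow> G x" for x
  proof (rule tendsto_eventually)
    define n0 where "n0 = Max (insert 0 (to_nat ` {i. H i x \<noteq> 0}))"
    have "Gn n x = G x" if "n0 \<le> n" for n
    proof -
      have "to_nat i \<le> n0" if "H i x \<noteq> 0" for i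
        unfolding n0_def using fin[of x] that by (intro Max_ge) auto
      then have "{i. H i x \<noteq> 0} \<subseteq> T n"
        using that by (force simp: T_def)
      then show ?thesis
        unfolding Gn_def G_def by (intro sum.mono_neutral_right finT) auto
    qed
    then show "\<forall>\<^sub>F n in sequentially. Gn n x = G x"
      unfolding eventually_sequentially by blast
  qed
  show G [measurable]: "G \<in> borel_measurable M"
    by (rule borel_measurable_LIMSEQ_metric[OF _ lim]) auto
  have pointwise: "(cmod (Gn n x))\<^sup>2 \<le> real K * (\<Sum>i\<in>T n. (cmod (H i x))\<^sup>2)" for n x
  proof -
    let ?Z = "{i \<in> T n. H i x \<noteq> 0}"
    have cardZ: "card ?Z \<le> K"
      by (rule order.trans[OF card_mono[OF fin] card]) auto
    \<comment> \<open>The factor 1 sets up Cauchy-Schwarz against the constant sequence, whose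
      squared norm is \<open>card ?Z\<close>.\<close>
    have "Gn n x = (\<Sum>i\<in>?Z. 1 * H i x)"
      unfolding Gn_def by (simp, intro sum.mono_neutral_right finT) auto
    then have "(cmod (Gn n x))\<^sup>2 \<le> (\<Sum>i\<in>?Z. (cmod 1)\<^sup>2) * (\<Sum>i\<in>?Z. (cmod (H i x))\<^sup>2)"
      by (simp only: sum_cauchy_schwarz_complex)
    also have "\<dots> \<le> real K * (\<Sum>i\<in>T n. (cmod (H i x))\<^sup>2)"
      using cardZ finT by (intro mult_mono sum_mono2 sum_nonneg) auto
    finally show ?thesis .
  qed
  have le_n: "(\<integral>\<^sup>+x. ennreal ((cmod (Gn n x))\<^sup>2) \<partial>M) \<le> ennreal (real K * c)" for n
  proof -
    have int_n: "integrable M (\<lambda>x. real K * (\<Sum>i\<in>T n. (cmod (H i x))\<^sup>2))"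
      using int by (intro integrable_mult_right Bochner_Integration.integrable_sum) auto
    have "(\<integral>\<^sup>+x. ennreal ((cmod (Gn n x))\<^sup>2) \<partial>M)
        \<le> (\<integral>\<^sup>+x. ennreal (real K * (\<Sum>i\<in>T n. (cmod (H i x))\<^sup>2)) \<partial>M)"
      by (intro nn_integral_mono ennreal_leI pointwise)
    also have "\<dots> = ennreal (LINT x|M. real K * (\<Sum>i\<in>T n. (cmod (H i x))\<^sup>2))"
      by (intro nn_integral_eq_integral int_n AE_I2 mult_nonneg_nonneg sum_nonneg) auto
    also have "(LINT x|M. real K * (\<Sum>i\<in>T n. (cmod (H i x))\<^sup>2))
        = real K * (\<Sum>i\<in>T n. LINT x|M. (cmod (H i x))\<^sup>2)"
      using int by simp
    also have "ennreal \<dots> \<le> ennreal (real K * c)"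
      by (intro ennreal_leI mult_left_mono bound finT) auto
    finally show ?thesis .
  qed
  have "(\<integral>\<^sup>+x. ennreal ((cmod (G x))\<^sup>2) \<partial>M)
      = (\<integral>\<^sup>+x. liminf (\<lambda>n. ennreal ((cmod (Gn n x))\<^sup>2)) \<partial>M)"
  proof (intro nn_integral_cong)
    fix x
    have "(\<lambda>n. ennreal ((cmod (Gn n x))\<^sup>2)) \<longlonglongrightarrow> ennreal ((cmod (G x))\<^sup>2)"
      by (intro tendsto_ennrealI tendsto_power tendsto_norm lim)
    then show "ennreal ((cmod (G x))\<^sup>2) = liminf (\<lambda>n. ennreal ((cmod (Gn n x))\<^sup>2))"
      by (intro lim_imp_Liminf[symmetric]) auto
  qed
  also have "\<dots> \<le> liminf (\<lambda>n. \<integral>\<^sup>+x. ennreal ((cmod (Gn n x))\<^sup>2) \<partial>M)"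
    by (intro nn_integral_liminf) measurable
  also have "\<dots> \<le> liminf (\<lambda>n. ennreal (real K * c))"
    by (intro Liminf_mono always_eventually allI le_n)
  also have "\<dots> = ennreal (real K * c)"
    by (intro Liminf_const) simp
  finally have le: "(\<integral>\<^sup>+x. ennreal ((cmod (G x))\<^sup>2) \<partial>M) \<le> ennreal (real K * c)" .
  show integ: "integrable M (\<lambda>x. (cmod (G x))\<^sup>2)"
    by (rule integrableI_bounded) (use le in \<open>auto intro: order.strict_trans1[OF _ ennreal_less_top]\<close>)
  have "0 \<le> c"
    using bound[of "{}"] by simp
  with le show "(LINT x|M. (cmod (G x))\<^sup>2) \<le> real K * c"
    using nn_integral_eq_integral[OF integ] by (auto simp: ennreal_le_iff)
qed

lemma real_interval_dyadic: "real_interval (dyadic q)"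
proof -
  have "is_interval (dyadic q)"
    unfolding dyadic_def by (auto simp: is_interval_1)
  moreover have "bounded (dyadic q)"
    unfolding dyadic_def by simp
  ultimately show ?thesis
    using dlen_pos[of q] by (simp add: real_interval_def dyadic_def)
qed

lemma ilen_dyadic: "ilen (dyadic q) = dlen q"
  using dlen_pos[of q] by (simp add: ilen_def dyadic_def)

lemma ddouble_subset_triple: "ddouble q \<subseteq> triple (dyadic q)"
  unfolding triple_def ilen_dyadic using dlen_pos[of q]
  by (auto simp: ddouble_def dyadic_def algebra_simps)

lemma dyadic_subset_ddouble: "dyadic q \<subseteq> ddouble q"
  using dlen_pos[of q] by (auto simp: ddouble_def dyadic_def)

text \<open>Needed because the final family is indexed by the intervals as sets, from which the
  index pair is recovered by \<open>inv dyadic\<close>.\<close>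

lemma inj_dyadic: "inj dyadic"
proof (rule injI)
  fix q r assume eq: "dyadic q = dyadic r"
  have "dyadic q \<inter> dyadic r \<noteq> {}"
    using eq dleft_in_dyadic[of q] by auto
  moreover have "dlen q = dlen r"
    using ilen_dyadic[of q] ilen_dyadic[of r] eq by simp
  then have "\<not> fst q < fst r" "\<not> fst r < fst q"
    unfolding dlen_def by (auto dest: power_int_strict_increasing[of _ _ "2::real"])
  then have "fst q = fst r"
    by simp
  ultimately show "q = r"
    by (intro dyadic_disjoint_or_eq)
qed

section \<open>Stopping intervals of \<open>f\<close> and their moment corrections\<close>

locale multifrequency =
  fixes N :: nat and \<xi> :: "nat \<Rightarrow> real" and f :: "real \<Rightarrow> complex" and lam :: real
  assumes N: "1 \<le> N" and f: "integrable lborel f" and lam: "0 < lam"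
begin

text \<open>Stopping at level \<open>\<lambda> / sqrt N\<close> rather than \<open>\<lambda>\<close> makes the intervals cover a set of size
  \<open>sqrt N \<parallel>f\<parallel> / \<lambda>\<close>, and the projection costs a factor \<open>sqrt N\<close> in \<open>L\<^sup>2\<close>.\<close>

definition level :: real where
  "level = lam / sqrt (real N)"

definition \<Omega> :: "real set" where
  "\<Omega> = (\<Union>q\<in>heavy_dyadic (\<lambda>x. cmod (f x)) level. dtriple q)"

definition S :: "(int \<times> int) set" where
  "S = whitney \<Omega>"

abbreviation mass :: real where
  "mass \<equiv> (LINT x|lborel. cmod (f x))"

lemma level_pos: "0 < level"
  using N lam by (simp add: level_def)

lemma norm_f: "integrable lborel (\<lambda>x. cmod (f x))"
  using f by simp

lemma Omega_borel [measurable]: "\<Omega> \<in> sets borel"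
  unfolding \<Omega>_def by (auto intro!: sets.countable_UN')

lemma emeasure_Omega_le: "emeasure lborel \<Omega> \<le> ennreal (3 * mass / level)"
  unfolding \<Omega>_def by (intro emeasure_UN_dtriple_heavy_le norm_f level_pos) auto

lemma emeasure_Omega_finite: "emeasure lborel \<Omega> < \<infinity>"
  using order.strict_trans1[OF emeasure_Omega_le ennreal_less_top] by simp

lemma mass_nonneg: "0 \<le> mass"
  by (intro integral_nonneg_AE) auto

lemma sum_dlen_le:
  assumes "finite T" "T \<subseteq> S"
  shows "(\<Sum>q\<in>T. dlen q) \<le> 3 * sqrt (real N) * mass / lam"
proof -
  have "ennreal (\<Sum>q\<in>T. dlen q) \<le> ennreal (3 * mass / level)"
    using sum_dlen_whitney_le[OF Omega_borel, of T] assms emeasure_Omega_le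
    unfolding S_def by (metis order.trans)
  moreover have "0 \<le> 3 * mass / level"
    using mass_nonneg level_pos by simp
  ultimately show ?thesis
    by (simp only: ennreal_le_iff) (simp add: level_def mult_ac)
qed

text \<open>By maximality the triple of the parent leaves \<open>\<Omega>\<close>, so the parent is
  not heavy; the factor 2 is its length relative to \<open>q\<close>.\<close>

lemma mass_dyadic_le:
  assumes q: "q \<in> S"
  shows "(LINT x:dyadic q|lborel. cmod (f x)) \<le> 2 * level * dlen q"
proof -
  have "\<not> dtriple (dparent q) \<subseteq> \<Omega>"
    using dparent_notin_if_maximal q unfolding S_def whitney_def by blast
  then have "dparent q \<notin> heavy_dyadic (\<lambda>x. cmod (f x)) level"
    unfolding \<Omega>_def by blast
  then have le: "(LINT x:dyadic (dparent q)|lborel. cmod (f x)) \<le> 2 * level * dlen q"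
    by (simp add: heavy_dyadic_def)
  have "set_integrable lborel (dyadic r) (\<lambda>x. cmod (f x))" for r
    unfolding set_integrable_def by (intro integrable_mult_indicator norm_f) auto
  then have "(LINT x:dyadic q|lborel. cmod (f x)) \<le> (LINT x:dyadic (dparent q)|lborel. cmod (f x))"
    using dyadic_subset_dparent[of q]
    unfolding set_lebesgue_integral_def set_integrable_def
    by (intro integral_mono) (auto simp: indicator_def)
  with le show ?thesis by simp
qed

lemma disjoint_S: "disjoint_family_on dyadic S"
  unfolding S_def whitney_def by (rule disjoint_maximal_dyadic)

lemma moment_correction:
  assumes q: "q \<in> S"
  shows "\<exists>h. continuous_on UNIV h \<and>
      (\<forall>j<N. (LINT x:ddouble q|lborel. h x * cis (\<xi> (Suc j) * x))
           = (LINT x:dyadic q|lborel. f x * cis (\<xi> (Suc j) * x))) \<and>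
      (LINT x:ddouble q|lborel. (cmod (h x))\<^sup>2) \<le> 8 * lam\<^sup>2 * dlen q"
proof -
  define m where "m = dleft q + dlen q / 2"
  have D: "ddouble q = {m - dlen q..m + dlen q}"
    by (simp add: ddouble_def m_def)
  have sub: "dyadic q \<subseteq> {m - dlen q / 2..m + dlen q / 2}"
    by (auto simp: dyadic_def m_def)
  have fi: "set_integrable lborel (dyadic q) f"
    unfolding set_integrable_def by (intro integrable_mult_indicator f) auto
  obtain h where h: "continuous_on UNIV h"
    "\<forall>j<N. (LINT x:ddouble q|lborel. h x * cis (\<xi> (Suc j) * x))
        = (LINT x:dyadic q|lborel. f x * cis (\<xi> (Suc j) * x))"
    "(LINT x:ddouble q|lborel. (cmod (h x))\<^sup>2) * dlen q
        \<le> 2 * real N * (LINT x:dyadic q|lborel. cmod (f x))\<^sup>2"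
    using exponential_moment_representation[OF dlen_pos sub fi, where N = N and \<xi> = "\<lambda>j. \<xi> (Suc j)"]
    unfolding D by blast
  have "0 \<le> (LINT x:dyadic q|lborel. cmod (f x))"
    unfolding set_lebesgue_integral_def by (intro integral_nonneg_AE) auto
  then have "(LINT x:dyadic q|lborel. cmod (f x))\<^sup>2 \<le> (2 * level * dlen q)\<^sup>2"
    by (intro power_mono mass_dyadic_le q)
  then have "2 * real N * (LINT x:dyadic q|lborel. cmod (f x))\<^sup>2 \<le> 2 * real N * (2 * level * dlen q)\<^sup>2"
    by (intro mult_left_mono) auto
  \<comment> \<open>Here \<open>N * level\<^sup>2 = lam\<^sup>2\<close>, so the factor
    \<open>N\<close> from the evaluation bound cancels and \<open>8 = 2 * 2\<^sup>2\<close>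
    remains.\<close>
  also have "\<dots> = (8 * lam\<^sup>2 * dlen q) * dlen q"
    using N by (simp add: level_def power_mult_distrib power_divide) (simp add: power2_eq_square)
  finally have "(LINT x:ddouble q|lborel. (cmod (h x))\<^sup>2) * dlen q \<le> (8 * lam\<^sup>2 * dlen q) * dlen q"
    using h(3) by linarith
  then have "(LINT x:ddouble q|lborel. (cmod (h x))\<^sup>2) \<le> 8 * lam\<^sup>2 * dlen q"
    using dlen_pos[of q] by (simp only: mult_le_cancel_right_pos)
  with h show ?thesis by blast
qed

definition correction :: "int \<times> int \<Rightarrow> real \<Rightarrow> complex" where
  "correction q = (SOME h. continuous_on UNIV h \<and>
      (\<forall>j<N. (LINT x:ddouble q|lborel. h x * cis (\<xi> (Suc j) * x))
           = (LINT x:dyadic q|lborel. f x * cis (\<xi> (Suc j) * x))) \<and>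
      (LINT x:ddouble q|lborel. (cmod (h x))\<^sup>2) \<le> 8 * lam\<^sup>2 * dlen q)"

lemma correction:
  assumes "q \<in> S"
  shows "continuous_on UNIV (correction q)"
    "j < N \<Longrightarrow> (LINT x:ddouble q|lborel. correction q x * cis (\<xi> (Suc j) * x))
           = (LINT x:dyadic q|lborel. f x * cis (\<xi> (Suc j) * x))"
    "(LINT x:ddouble q|lborel. (cmod (correction q x))\<^sup>2) \<le> 8 * lam\<^sup>2 * dlen q"
  using someI_ex[OF moment_correction[OF assms]] unfolding correction_def[symmetric] by blast+

text \<open>Extension by zero, in \<open>x\<close> and for indices outside \<open>S\<close>, lets
  the overlap lemma run over the whole countable index type.\<close>

definition H :: "int \<times> int \<Rightarrow> real \<Rightarrow> complex" where
  "H q x = (if q \<in> S then indicator (ddouble q) x *\<^sub>R correction q x else 0)"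

definition G :: "real \<Rightarrow> complex" where
  "G x = (\<Sum>q | H q x \<noteq> 0. H q x)"

lemma H_integrable: "integrable lborel (H q)"
proof (cases "q \<in> S")
  case True
  have "set_integrable lborel (ddouble q) (correction q)"
    unfolding ddouble_def
    by (intro borel_integrable_atLeastAtMost' continuous_on_subset[OF correction(1)[OF True]]) auto
  then show ?thesis
    unfolding set_integrable_def H_def[abs_def] using True by simp
qed (simp add: H_def[abs_def])

lemma H_mult_cis:
  assumes "q \<in> S" "j < N"
  shows "(LINT x|lborel. H q x * cis (\<xi> (Suc j) * x)) = (LINT x:dyadic q|lborel. f x * cis (\<xi> (Suc j) * x))"
  using correction(2)[OF assms] assms(1)
  by (simp add: H_def set_lebesgue_integral_def)

lemma H_square:
  "integrable lborel (\<lambda>x. (cmod (H q x))\<^sup>2)"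
  "q \<in> S \<Longrightarrow> (LINT x|lborel. (cmod (H q x))\<^sup>2) \<le> 8 * lam\<^sup>2 * dlen q"
proof -
  have eq: "(cmod (H q x))\<^sup>2 = indicator (ddouble q) x *\<^sub>R (cmod (correction q x))\<^sup>2" if "q \<in> S" for x
    using that by (auto simp: H_def indicator_def)
  show "integrable lborel (\<lambda>x. (cmod (H q x))\<^sup>2)"
  proof (cases "q \<in> S")
    case True
    have "set_integrable lborel (ddouble q) (\<lambda>x. (cmod (correction q x))\<^sup>2)"
      unfolding ddouble_def
      by (intro borel_integrable_atLeastAtMost' continuous_intros
          continuous_on_subset[OF correction(1)[OF True]]) auto
    then show ?thesis
      unfolding set_integrable_def eq[OF True] .
  qed (simp add: H_def)
  show "(LINT x|lborel. (cmod (H q x))\<^sup>2) \<le> 8 * lam\<^sup>2 * dlen q" if "q \<in> S"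
    using correction(3)[OF that] unfolding set_lebesgue_integral_def eq[OF that] .
qed

lemma H_overlap: "finite {q. H q x \<noteq> 0}" "card {q. H q x \<noteq> 0} \<le> 21"
proof -
  have sub: "{q. H q x \<noteq> 0} \<subseteq> {q \<in> whitney \<Omega>. x \<in> ddouble q}"
    by (auto simp: H_def S_def indicator_def split: if_splits)
  show "finite {q. H q x \<noteq> 0}"
    using finite_subset[OF sub whitney_overlap(1)] .
  show "card {q. H q x \<noteq> 0} \<le> 21"
    using order.trans[OF card_mono[OF whitney_overlap(1) sub] whitney_overlap(2)] .
qed

lemma sum_H_square_le:
  assumes "finite T"
  shows "(\<Sum>q\<in>T. LINT x|lborel. (cmod (H q x))\<^sup>2) \<le> 24 * lam * sqrt (real N) * mass"
proof -
  have "(\<Sum>q\<in>T. LINT x|lborel. (cmod (H q x))\<^sup>2) = (\<Sum>q\<in>T \<inter> S. LINT x|lborel. (cmod (H q x))\<^sup>2)"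
    using assms by (intro sum.mono_neutral_right) (auto simp: H_def)
  also have "\<dots> \<le> (\<Sum>q\<in>T \<inter> S. 8 * lam\<^sup>2 * dlen q)"
    by (intro sum_mono H_square) auto
  also have "\<dots> = 8 * lam\<^sup>2 * (\<Sum>q\<in>T \<inter> S. dlen q)"
    by (simp add: sum_distrib_left)
  also have "\<dots> \<le> 8 * lam\<^sup>2 * (3 * sqrt (real N) * mass / lam)"
    using assms by (intro mult_left_mono sum_dlen_le) auto
  also have "\<dots> = 24 * lam * sqrt (real N) * mass"
    using lam by (simp add: power2_eq_square)
  finally show ?thesis .
qed

text \<open>The constant is \<open>504 = 21 * 24\<close>: the overlap number times the bound on the
  sum of the squared norms.\<close>

lemma G_square:
  "G \<in> borel_measurable lborel" "integrable lborel (\<lambda>x. (cmod (G x))\<^sup>2)"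
  "(LINT x|lborel. (cmod (G x))\<^sup>2) \<le> 504 * lam * sqrt (real N) * mass"
proof -
  have G: "G = (\<lambda>x. \<Sum>q | H q x \<noteq> 0. H q x)"
    by (simp add: G_def fun_eq_iff)
  have m: "H q \<in> borel_measurable lborel" for q
    using H_integrable[of q] by (rule borel_measurable_integrable)
  note sq = square_integral_finite_overlap_sum[of H lborel, OF m H_overlap H_square(1) sum_H_square_le,
      folded G]
  show "G \<in> borel_measurable lborel" "integrable lborel (\<lambda>x. (cmod (G x))\<^sup>2)"
    using sq(1,2) by (simp_all add: G_def)
  show "(LINT x|lborel. (cmod (G x))\<^sup>2) \<le> 504 * lam * sqrt (real N) * mass"
    using sq(3) by (simp add: G_def)
qed

section \<open>Good and bad parts\<close>

definition E :: "real set" where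
  "E = (\<Union>q\<in>S. dyadic q)"

lemma E_borel [measurable]: "E \<in> sets borel"
  unfolding E_def by (auto intro!: sets.countable_UN')

text \<open>The triple of a heavy interval lies in \<open>\<Omega>\<close>, so the interval lies in
  a Whitney interval and hence in \<open>E\<close>. Intervals meeting the complement are therefore
  not heavy, and differentiation applies.\<close>

lemma AE_norm_le_level: "AE x in lborel. x \<in> - E \<longrightarrow> cmod (f x) \<le> level"
proof (rule AE_le_if_dyadic_averages_le[OF norm_f _ level_pos])
  fix q assume meets: "dyadic q \<inter> - E \<noteq> {}"
  have "q \<notin> heavy_dyadic (\<lambda>x. cmod (f x)) level"
  proof
    assume "q \<in> heavy_dyadic (\<lambda>x. cmod (f x)) level"
    then have "dtriple q \<subseteq> \<Omega>"
      unfolding \<Omega>_def by blast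
    then obtain r where "r \<in> S" "dyadic q \<subseteq> dyadic r"
      using exists_whitney_superset[OF Omega_borel emeasure_Omega_finite] unfolding S_def by blast
    then show False
      using meets unfolding E_def by blast
  qed
  then show "(LINT x:dyadic q|lborel. cmod (f x)) \<le> level * dlen q"
    by (simp add: heavy_dyadic_def)
qed auto

definition good :: "real \<Rightarrow> complex" where
  "good x = indicator (- E) x *\<^sub>R f x + G x"

definition bad :: "int \<times> int \<Rightarrow> real \<Rightarrow> complex" where
  "bad q x = indicator (dyadic q) x *\<^sub>R f x - H q x"

lemma good_measurable: "good \<in> borel_measurable lborel"
  unfolding good_def[abs_def] using G_square(1) f by measurable

text \<open>Off \<open>E\<close> the pointwise bound turns \<open>(cmod (f x))\<^sup>2\<close> into
  \<open>level * cmod (f x)\<close>, which integrates to at most \<open>level * mass\<close>.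
  Splitting the square of the sum doubles both terms, whence \<open>1010 = 2 + 2 * 504\<close> after
  the crude estimate \<open>level \<le> lam * sqrt N\<close>.\<close>

lemma good_square:
  "integrable lborel (\<lambda>x. (cmod (good x))\<^sup>2)"
  "(LINT x|lborel. (cmod (good x))\<^sup>2) \<le> 1010 * mass * sqrt (real N) * lam"
proof -
  have ae: "AE x in lborel. (cmod (good x))\<^sup>2 \<le> 2 * level * cmod (f x) + 2 * (cmod (G x))\<^sup>2"
    using AE_norm_le_level
  proof (rule AE_mp, intro AE_I2 impI)
    fix x assume *: "x \<in> - E \<longrightarrow> cmod (f x) \<le> level"
    let ?u = "indicator (- E) x *\<^sub>R f x"
    have "(cmod (?u + G x))\<^sup>2 \<le> (cmod ?u + cmod (G x))\<^sup>2"
      by (intro power_mono norm_triangle_ineq) auto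
    also have "\<dots> \<le> 2 * (cmod ?u)\<^sup>2 + 2 * (cmod (G x))\<^sup>2"
      using sum_squares_bound[of "cmod ?u" "cmod (G x)"] by (simp add: power2_sum)
    also have "(cmod ?u)\<^sup>2 \<le> level * cmod (f x)"
      using * level_pos by (auto simp: indicator_def power2_eq_square intro: mult_right_mono)
    finally show "(cmod (good x))\<^sup>2 \<le> 2 * level * cmod (f x) + 2 * (cmod (G x))\<^sup>2"
      by (simp add: good_def)
  qed
  have int: "integrable lborel (\<lambda>x. 2 * level * cmod (f x) + 2 * (cmod (G x))\<^sup>2)"
    using norm_f G_square(2) by auto
  show integ: "integrable lborel (\<lambda>x. (cmod (good x))\<^sup>2)"
  proof (rule Bochner_Integration.integrable_bound[OF int])
    show "(\<lambda>x. (cmod (good x))\<^sup>2) \<in> borel_measurable lborel"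
      using good_measurable by measurable
    show "AE x in lborel. norm ((cmod (good x))\<^sup>2) \<le> norm (2 * level * cmod (f x) + 2 * (cmod (G x))\<^sup>2)"
      using ae by (rule AE_mp) (auto intro!: AE_I2)
  qed
  have "(LINT x|lborel. (cmod (good x))\<^sup>2) \<le> (LINT x|lborel. 2 * level * cmod (f x) + 2 * (cmod (G x))\<^sup>2)"
    by (intro integral_mono_AE integ int ae)
  also have "\<dots> = 2 * level * mass + 2 * (LINT x|lborel. (cmod (G x))\<^sup>2)"
    using norm_f G_square(2) by simp
  also have "\<dots> \<le> 2 * (lam * sqrt (real N)) * mass + 2 * (504 * lam * sqrt (real N) * mass)"
  proof (intro add_mono mult_right_mono mult_left_mono mass_nonneg G_square)
    have "1 \<le> sqrt (real N)"
      using N by simp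
    then have "lam / sqrt (real N) \<le> lam / 1" "lam * 1 \<le> lam * sqrt (real N)"
      using lam by (intro divide_left_mono mult_left_mono; simp)+
    then show "level \<le> lam * sqrt (real N)"
      by (simp add: level_def)
  qed auto
  finally show "(LINT x|lborel. (cmod (good x))\<^sup>2) \<le> 1010 * mass * sqrt (real N) * lam"
    by (simp add: mult_ac)
qed

text \<open>At every point only finitely many terms are nonzero: at most one from the disjoint
  intervals and at most 21 from the corrections. The sum is thus \<open>f\<close> on
  \<open>E\<close> minus \<open>G\<close>, which is \<open>f - good\<close>.\<close>

lemma bad_has_sum: "((\<lambda>q. bad q x) has_sum (f x - good x)) S"
proof -
  have 1: "((\<lambda>q. H q x) has_sum G x) S"
    by (rule has_sum_finite_neutralI[where B = "{q. H q x \<noteq> 0}"])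
      (use H_overlap(1)[of x] in \<open>auto simp: G_def H_def\<close>)
  have 2: "((\<lambda>q. indicator (dyadic q) x *\<^sub>R f x) has_sum (indicator E x *\<^sub>R f x)) S"
  proof (cases "x \<in> E")
    case True
    then obtain q where q: "q \<in> S" "x \<in> dyadic q"
      by (auto simp: E_def)
    have "x \<notin> dyadic r" if "r \<in> S" "r \<noteq> q" for r
      using disjoint_family_onD[OF disjoint_S that(1) q(1) that(2)] q(2) by blast
    then show ?thesis
      using q True by (intro has_sum_finite_neutralI[where B = "{q}"]) auto
  next
    case False
    then have "x \<notin> dyadic q" if "q \<in> S" for q
      using that by (auto simp: E_def)
    with False show ?thesis
      by (intro has_sum_finite_neutralI[where B = "{}"]) auto
  qed
  have "indicator E x *\<^sub>R f x - G x = f x - good x"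
    by (auto simp: good_def indicator_def)
  moreover have "((\<lambda>q. - H q x) has_sum - G x) S"
    using 1 by (simp add: has_sum_uminus)
  ultimately show ?thesis
    using has_sum_add[OF 2] by (fastforce simp: bad_def)
qed

lemma bad_integrable: "integrable lborel (bad q)"
  unfolding bad_def[abs_def]
  by (intro Bochner_Integration.integrable_diff integrable_mult_indicator f H_integrable) auto

lemma bad_support: "x \<notin> triple (dyadic q) \<Longrightarrow> bad q x = 0"
  using ddouble_subset_triple[of q] dyadic_subset_ddouble[of q]
  by (auto simp: bad_def H_def indicator_def)

lemma bad_moments:
  assumes "q \<in> S" "j \<in> {1..N}"
  shows "(LINT x|lborel. bad q x * cis (\<xi> j * x)) = 0"
proof -
  obtain i where i: "j = Suc i" "i < N"
    using assms(2) by (cases j) auto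
  have mult_cis: "integrable lborel (\<lambda>x. u x * cis (\<xi> j * x))"
    if u: "integrable lborel u" for u :: "real \<Rightarrow> complex"
  proof (rule Bochner_Integration.integrable_bound[OF u])
    have "(\<lambda>x. cis (\<xi> j * x)) \<in> borel_measurable borel"
      by (intro borel_measurable_continuous_onI continuous_on_cis_mult)
    then show "(\<lambda>x. u x * cis (\<xi> j * x)) \<in> borel_measurable lborel"
      using u by (intro borel_measurable_times) auto
  qed (simp add: norm_mult)
  have "(LINT x|lborel. bad q x * cis (\<xi> j * x))
      = (LINT x|lborel. (indicator (dyadic q) x *\<^sub>R f x) * cis (\<xi> j * x))
        - (LINT x|lborel. H q x * cis (\<xi> j * x))"
    unfolding bad_def left_diff_distrib
    by (intro Bochner_Integration.integral_diff mult_cis integrable_mult_indicator f H_integrable) auto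
  then show ?thesis
    using H_mult_cis[OF assms(1) i(2)] i(1) by (simp add: set_lebesgue_integral_def)
qed

section \<open>Assembling the decomposition\<close>

lemma decomposition:
  "\<exists>(\<I>::real set set) (g::real \<Rightarrow> complex) (b::real set \<Rightarrow> real \<Rightarrow> complex).
       (\<forall>I\<in>\<I>. real_interval I) \<and>
       (\<forall>I\<in>\<I>. \<forall>J\<in>\<I>. I \<noteq> J \<longrightarrow> I \<inter> J = {}) \<and>
       (AE x in lborel. ((\<lambda>I. b I x) has_sum (f x - g x)) \<I>) \<and>
       ilen summable_on \<I> \<and>
       infsum ilen \<I> \<le> 1010 * sqrt (real N) * (LINT x|lborel. cmod (f x)) / lam \<and>
       g \<in> borel_measurable lborel \<and>
       integrable lborel (\<lambda>x. (cmod (g x))^2) \<and>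
       (LINT x|lborel. (cmod (g x))^2) \<le> 1010 * (LINT x|lborel. cmod (f x)) * sqrt (real N) * lam \<and>
       (\<forall>I\<in>\<I>.
          integrable lborel (b I) \<and>
          (\<forall>x. x \<notin> triple I \<longrightarrow> b I x = 0) \<and>
          (LINT x|lborel. indicator I x * cmod (f x)) \<le> 1010 * ilen I * lam \<and>
          integrable lborel (\<lambda>x. (cmod (indicator I x * f x - b I x))^2) \<and>
          sqrt (LINT x|lborel. (cmod (indicator I x * f x - b I x))^2)
            \<le> 1010 * sqrt (ilen I) * lam * sqrt (real N) \<and>
          (\<forall>j\<in>{1..N}. (LINT x|lborel. b I x * cis (\<xi> j * x)) = 0))"
proof (rule exI[of _ "dyadic ` S"], rule exI[of _ good], rule exI[of _ "\<lambda>I. bad (inv dyadic I)"],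
    intro conjI ballI impI allI)
  let ?b = "\<lambda>I. bad (inv dyadic I)"
  have inv [simp]: "inv dyadic (dyadic q) = q" for q
    by (rule inv_f_f[OF inj_dyadic])
  have inj: "inj_on dyadic S"
    using inj_dyadic by (rule inj_on_subset) simp
  show "AE x in lborel. ((\<lambda>I. ?b I x) has_sum (f x - good x)) (dyadic ` S)"
    using bad_has_sum by (intro AE_I2) (simp add: has_sum_reindex[OF inj] o_def)
  have comp: "ilen \<circ> dyadic = dlen"
    by (auto simp: ilen_dyadic)
  \<comment> \<open>The lengths are nonnegative and their finite partial sums are bounded by
    \<open>sum_dlen_le\<close>.\<close>
  have summ: "dlen summable_on S"
    by (rule nonneg_bounded_partial_sums_imp_summable_on)
      (auto intro!: eventually_finite_subsets_at_top_weakI sum_dlen_le)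
  then show "ilen summable_on dyadic ` S"
    by (simp add: summable_on_reindex[OF inj] comp)
  have "infsum dlen S \<le> 3 * sqrt (real N) * mass / lam"
    by (intro infsum_le_finite_sums summ sum_dlen_le)
  also have "\<dots> \<le> 1010 * sqrt (real N) * mass / lam"
    using lam mass_nonneg by (intro divide_right_mono mult_right_mono) auto
  finally show "infsum ilen (dyadic ` S) \<le> 1010 * sqrt (real N) * mass / lam"
    by (simp add: infsum_reindex[OF inj] comp)
  show "good \<in> borel_measurable lborel" "integrable lborel (\<lambda>x. (cmod (good x))\<^sup>2)"
    "(LINT x|lborel. (cmod (good x))\<^sup>2) \<le> 1010 * mass * sqrt (real N) * lam"
    using good_measurable good_square by auto
  fix I assume "I \<in> dyadic ` S"
  then obtain q where q: "q \<in> S" and I: "I = dyadic q" by blast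
  show "real_interval I"
    by (simp add: I real_interval_dyadic)
  show "integrable lborel (?b I)"
    by (simp add: I bad_integrable)
  show "?b I x = 0" if "x \<notin> triple I" for x
    using that by (simp add: I bad_support)
  show "(LINT x|lborel. ?b I x * cis (\<xi> j * x)) = 0" if "j \<in> {1..N}" for j
    using bad_moments[OF q that] by (simp add: I)
  show "I \<inter> J = {}" if J: "J \<in> dyadic ` S" "I \<noteq> J" for J
  proof -
    obtain r where "r \<in> S" "J = dyadic r"
      using J(1) by blast
    then show ?thesis
      using disjoint_family_onD[OF disjoint_S q, of r] I J(2) by blast
  qed
  have N1: "1 \<le> sqrt (real N)"
    using N by simp
  have "(LINT x|lborel. indicator I x * cmod (f x)) \<le> 2 * level * dlen q"
    using mass_dyadic_le[OF q] by (simp add: I set_lebesgue_integral_def)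
  also have "\<dots> \<le> 1010 * lam * dlen q"
  proof (intro mult_right_mono mult_mono)
    have "lam / sqrt (real N) \<le> lam / 1"
      using lam N1 by (intro divide_left_mono) auto
    then show "level \<le> lam"
      by (simp add: level_def)
  qed (use level_pos in auto)
  finally show "(LINT x|lborel. indicator I x * cmod (f x)) \<le> 1010 * ilen I * lam"
    by (simp add: I ilen_dyadic mult_ac)
  have diff: "indicator I x * f x - ?b I x = H q x" for x
    by (auto simp: I bad_def indicator_def)
  show "integrable lborel (\<lambda>x. (cmod (indicator I x * f x - ?b I x))\<^sup>2)"
    unfolding diff by (rule H_square)
  \<comment> \<open>The constant 8 is rounded up to \<open>3\<^sup>2\<close> so that the square root
    is exact.\<close>
  have "sqrt (LINT x|lborel. (cmod (H q x))\<^sup>2) \<le> sqrt (3\<^sup>2 * lam\<^sup>2 * dlen q)"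
    using H_square(2)[OF q] lam
    by (intro real_sqrt_le_mono order.trans[OF H_square(2)[OF q]] mult_right_mono) auto
  also have "\<dots> = 3 * sqrt (dlen q) * lam * 1"
    using lam by (simp add: real_sqrt_mult)
  also have "\<dots> \<le> 1010 * sqrt (dlen q) * lam * sqrt (real N)"
    using lam N1 by (intro mult_mono) auto
  finally show "sqrt (LINT x|lborel. (cmod (indicator I x * f x - ?b I x))\<^sup>2)
      \<le> 1010 * sqrt (ilen I) * lam * sqrt (real N)"
    unfolding diff by (simp add: I ilen_dyadic)
qed

end

theorem theorem1:
  shows "\<exists>C::real. \<forall>(N::nat) (\<xi>::nat \<Rightarrow> real) (f::real \<Rightarrow> complex) (lam::real).
    N \<ge> 1 \<longrightarrow> strict_mono_on {1..N} \<xi> \<longrightarrow> integrable lborel f \<longrightarrow> lam > 0 \<longrightarrow>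
    (\<exists>(\<I>::real set set) (g::real \<Rightarrow> complex) (b::real set \<Rightarrow> real \<Rightarrow> complex).
       (\<forall>I\<in>\<I>. real_interval I) \<and>
       (\<forall>I\<in>\<I>. \<forall>J\<in>\<I>. I \<noteq> J \<longrightarrow> I \<inter> J = {}) \<and>
       (AE x in lborel. ((\<lambda>I. b I x) has_sum (f x - g x)) \<I>) \<and>
       ilen summable_on \<I> \<and>
       infsum ilen \<I> \<le> C * sqrt (real N) * (LINT x|lborel. cmod (f x)) / lam \<and>
       g \<in> borel_measurable lborel \<and>
       integrable lborel (\<lambda>x. (cmod (g x))^2) \<and>
       (LINT x|lborel. (cmod (g x))^2) \<le> C * (LINT x|lborel. cmod (f x)) * sqrt (real N) * lam \<and>
       (\<forall>I\<in>\<I>.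
          integrable lborel (b I) \<and>
          (\<forall>x. x \<notin> triple I \<longrightarrow> b I x = 0) \<and>
          (LINT x|lborel. indicator I x * cmod (f x)) \<le> C * ilen I * lam \<and>
          integrable lborel (\<lambda>x. (cmod (indicator I x * f x - b I x))^2) \<and>
          sqrt (LINT x|lborel. (cmod (indicator I x * f x - b I x))^2)
            \<le> C * sqrt (ilen I) * lam * sqrt (real N) \<and>
          (\<forall>j\<in>{1..N}. (LINT x|lborel. b I x * cis (\<xi> j * x)) = 0)))"
\<comment> \<open>1010 is the largest of the constants obtained, coming from the \<open>L^2\<close>
  bound for the good part.\<close>
proof (intro exI[of _ 1010] allI impI)
  fix N :: nat and \<xi> :: "nat \<Rightarrow> real" and f :: "real \<Rightarrow> complex" and lam :: real
  assume "1 \<le> N" "integrable lborel f" "0 < lam"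
  then interpret multifrequency N \<xi> f lam
    by unfold_locales
  show "\<exists>(\<I>::real set set) (g::real \<Rightarrow> complex) (b::real set \<Rightarrow> real \<Rightarrow> complex).
       (\<forall>I\<in>\<I>. real_interval I) \<and>
       (\<forall>I\<in>\<I>. \<forall>J\<in>\<I>. I \<noteq> J \<longrightarrow> I \<inter> J = {}) \<and>
       (AE x in lborel. ((\<lambda>I. b I x) has_sum (f x - g x)) \<I>) \<and>
       ilen summable_on \<I> \<and>
       infsum ilen \<I> \<le> 1010 * sqrt (real N) * (LINT x|lborel. cmod (f x)) / lam \<and>
       g \<in> borel_measurable lborel \<and>
       integrable lborel (\<lambda>x. (cmod (g x))^2) \<and>
       (LINT x|lborel. (cmod (g x))^2) \<le> 1010 * (LINT x|lborel. cmod (f x)) * sqrt (real N) * lam \<and>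
       (\<forall>I\<in>\<I>.
          integrable lborel (b I) \<and>
          (\<forall>x. x \<notin> triple I \<longrightarrow> b I x = 0) \<and>
          (LINT x|lborel. indicator I x * cmod (f x)) \<le> 1010 * ilen I * lam \<and>
          integrable lborel (\<lambda>x. (cmod (indicator I x * f x - b I x))^2) \<and>
          sqrt (LINT x|lborel. (cmod (indicator I x * f x - b I x))^2)
            \<le> 1010 * sqrt (ilen I) * lam * sqrt (real N) \<and>
          (\<forall>j\<in>{1..N}. (LINT x|lborel. b I x * cis (\<xi> j * x)) = 0))"
    by (rule decomposition)
qed

end
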